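(* Let $n\ge 1$ be an integer, $0<\gamma<n$, $q=n/(n-\gamma)$ and $w\in A_{1,q}$. Assume that $1\le\alpha<\beta<s\le\infty$ with $1/\beta=1/\alpha-\gamma/n$, and that $\mu\in\Delta_2$. Then the fractional integral operator $I_\gamma$ is bounded from $(L^1,L^s)^{\alpha}(w,w^q;\mu)$ into $(WL^q,L^s)^{\beta}(w^q;\mu)$; that is, there is a constant $C>0$ independent of $f$ such that $\|I_\gamma f\|_{(WL^q,L^s)^{\beta}(w^q;\mu)}\le C\|f\|_{(L^1,L^s)^{\alpha}(w,w^q;\mu)}$ for all $f\in(L^1,L^s)^{\alpha}(w,w^q;\mu)$.
   Context: A weight is a non-negative locally integrable function on $\mathbb R^n$; for a weight $w$ and measurable $E$, $w(E)=\int_E w(x)\,dx$, and $w^q(E)=\int_E w(x)^q\,dx$. $B(y,r)$ is the open Euclidean ball with center $y$ and radius $r$. Fractional integral operator: $I_\gamma f(x)=\frac{1}{\zeta(\gamma)}\int_{\mathbb R^n}\frac{f(y)}{|x-y|^{n-\gamma}}\,dy$, with $\zeta(\gamma)=\frac{\pi^{n/2}2^\gamma\Gamma(\gamma/2)}{\Gamma((n-\gamma)/2)}$. For $1<q<\infty$, $w\in A_{1,q}$ means: there is $C>0$ such that for every ball $B$, $\left(\frac1{|B|}\int_B w^q\,dx\right)^{1/q}\left(\operatorname{ess\,sup}_{x\in B}\frac1{w(x)}\right)\le C$. $\mu\in\Delta_2$ means that $\mu$ is a weight and there is $C>0$ with $\mu(2B)\le C\mu(B)$ for every ball $B$ ($2B$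 is the concentric ball with twice the radius). Weighted amalgam spaces: for $1\le p\le\alpha\le s\le\infty$ and weights $\nu,w,\mu$, the space $(L^p,L^s)^{\alpha}(\nu,w;\mu)$ consists of all locally integrable $f$ with $$\|f\|_{(L^p,L^s)^{\alpha}(\nu,w;\mu)}:=\sup_{r>0}\Big\|w(B(y,r))^{1/\alpha-1/p-1/s}\,\|f\chi_{B(y,r)}\|_{L^p(\nu)}\Big\|_{L^s(\mu)}<\infty,$$ where the $L^s(\mu)$-norm (norm with respect to $\mu(y)\,dy$, usual modification when $s=\infty$) is taken in $y$, and $\|g\|_{L^p(\nu)}=(\int|g|^p\nu\,dx)^{1/p}$. The weak space $(WL^p,L^s)^{\alpha}(w;\mu)$ consists of all measurable $f$ with $$\|f\|_{(WL^p,L^s)^{\alpha}(w;\mu)}:=\sup_{r>0}\Big\|w(B(y,r))^{1/\alpha-1/p-1/s}\,\|f\chi_{B(y,r)}\|_{WL^p(w)}\Big\|_{L^s(\mu)}<\infty,$$ where $\|g\|_{WL^p(w)}=\sup_{\lambda>0}\lambda\,[w(\{x:|g(x)|>\lambda\})]^{1/p}$. *)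

theory Defs
  imports "HOL-Analysis.Analysis" "HOL-Probability.Essential_Supremum"
begin

text \<open>
  Norms take values in the type of extended non-negative reals, with its convention
  \<open>\<infinity> * 0 = 0\<close>. Measurability and integrals refer to Lebesgue (not Borel) measure.
  Functions on which the operators act are complex valued; weights are real valued.
\<close>

text \<open>The library's \<open>powr\<close> satisfies \<open>0 powr a = 0\<close> for every \<open>a\<close> and does not cover extended
  reals. Here \<open>0\<close> to a negative power is \<open>\<infinity>\<close>, and \<open>0\<close> and \<open>\<infinity>\<close> to the power \<open>0\<close> are \<open>1\<close>.\<close>

definition epowr :: "ennreal \<Rightarrow> real \<Rightarrow> ennreal" (infixr "epowr" 80) where
  "x epowr a =
     (if a = 0 then 1
      else if x = 0 then (if a > 0 then 0 else \<infinity>)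
      else if x = \<infinity> then (if a > 0 then \<infinity> else 0)
      else ennreal (enn2real x powr a))"

definition locally_integrable :: "(real^'n \<Rightarrow> 'b::euclidean_space) \<Rightarrow> bool" where
  "locally_integrable f \<longleftrightarrow> (\<forall>K. compact K \<longrightarrow> f absolutely_integrable_on K)"

definition weight :: "(real^'n \<Rightarrow> real) \<Rightarrow> bool" where
  "weight w \<longleftrightarrow> (\<forall>x. 0 \<le> w x) \<and> locally_integrable w"

definition wmeas :: "(real^'n \<Rightarrow> real) \<Rightarrow> (real^'n) set \<Rightarrow> ennreal" where
  "wmeas w E = (\<integral>\<^sup>+x\<in>E. ennreal (w x) \<partial>lebesgue)"

text \<open>In \<open>1 / ennreal (w x)\<close> the division is that of extended non-negative reals, so
  \<open>1 / 0 = \<infinity>\<close>.\<close>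

definition A1_class :: "real \<Rightarrow> (real^'n \<Rightarrow> real) set" where
  "A1_class q = {w. weight w \<and> (\<exists>C::real. C > 0 \<and> (\<forall>y r. r > 0 \<longrightarrow>
     (wmeas (\<lambda>x. w x powr q) (ball y r) / emeasure lebesgue (ball y r)) epowr (1 / q)
       * esssup (restrict_space lebesgue (ball y r)) (\<lambda>x. 1 / ennreal (w x))
     \<le> ennreal C))}"

definition Delta2 :: "(real^'n \<Rightarrow> real) set" where
  "Delta2 = {\<mu>. weight \<mu> \<and> (\<exists>C::real. C > 0 \<and> (\<forall>y r. r > 0 \<longrightarrow>
     wmeas \<mu> (ball y (2 * r)) \<le> ennreal C * wmeas \<mu> (ball y r)))}"

definition Lp_norm :: "real \<Rightarrow> (real^'n \<Rightarrow> real) \<Rightarrow> (real^'n \<Rightarrow> complex) \<Rightarrow> ennreal" where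
  "Lp_norm p \<nu> g = (\<integral>\<^sup>+x. ennreal (norm (g x) powr p * \<nu> x) \<partial>lebesgue) epowr (1 / p)"

definition weak_Lp_norm :: "real \<Rightarrow> (real^'n \<Rightarrow> real) \<Rightarrow> (real^'n \<Rightarrow> complex) \<Rightarrow> ennreal" where
  "weak_Lp_norm p w g = (SUP t\<in>{0<..}. ennreal t * wmeas w {x. norm (g x) > t} epowr (1 / p))"

text \<open>The outer norm, for a non-negative extended-real function and an exponent that may be
  \<open>\<infinity>\<close>.\<close>

definition Ls_norm :: "ennreal \<Rightarrow> (real^'n \<Rightarrow> real) \<Rightarrow> (real^'n \<Rightarrow> ennreal) \<Rightarrow> ennreal" where
  "Ls_norm s \<mu> G =
     (if s = \<infinity> then esssup (density lebesgue (\<lambda>y. ennreal (\<mu> y))) G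
      else (\<integral>\<^sup>+y. (G y epowr enn2real s) * ennreal (\<mu> y) \<partial>lebesgue) epowr (1 / enn2real s))"

definition restr :: "(real^'n) set \<Rightarrow> (real^'n \<Rightarrow> complex) \<Rightarrow> real^'n \<Rightarrow> complex" where
  "restr B f x = (if x \<in> B then f x else 0)"

text \<open>\<open>enn2real (1 / s)\<close> is \<open>1 / s\<close> for finite \<open>s \<noteq> 0\<close>, and \<open>0\<close> for \<open>s = \<infinity>\<close>.\<close>

definition amalgam_norm ::
  "real \<Rightarrow> ennreal \<Rightarrow> real \<Rightarrow> (real^'n \<Rightarrow> real) \<Rightarrow> (real^'n \<Rightarrow> real) \<Rightarrow> (real^'n \<Rightarrow> real)
     \<Rightarrow> (real^'n \<Rightarrow> complex) \<Rightarrow> ennreal" where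
  "amalgam_norm p s \<alpha> \<nu> w \<mu> f =
     (SUP r\<in>{0<..}. Ls_norm s \<mu> (\<lambda>y.
        (wmeas w (ball y r) epowr (1 / \<alpha> - 1 / p - enn2real (1 / s)))
          * Lp_norm p \<nu> (restr (ball y r) f)))"

definition amalgam ::
  "real \<Rightarrow> ennreal \<Rightarrow> real \<Rightarrow> (real^'n \<Rightarrow> real) \<Rightarrow> (real^'n \<Rightarrow> real) \<Rightarrow> (real^'n \<Rightarrow> real)
     \<Rightarrow> (real^'n \<Rightarrow> complex) set" where
  "amalgam p s \<alpha> \<nu> w \<mu> = {f. locally_integrable f \<and> amalgam_norm p s \<alpha> \<nu> w \<mu> f < \<infinity>}"

definition weak_amalgam_norm ::
  "real \<Rightarrow> ennreal \<Rightarrow> real \<Rightarrow> (real^'n \<Rightarrow> real) \<Rightarrow> (real^'n \<Rightarrow> real)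
     \<Rightarrow> (real^'n \<Rightarrow> complex) \<Rightarrow> ennreal" where
  "weak_amalgam_norm p s \<alpha> w \<mu> f =
     (SUP r\<in>{0<..}. Ls_norm s \<mu> (\<lambda>y.
        (wmeas w (ball y r) epowr (1 / \<alpha> - 1 / p - enn2real (1 / s)))
          * weak_Lp_norm p w (restr (ball y r) f)))"

definition weak_amalgam ::
  "real \<Rightarrow> ennreal \<Rightarrow> real \<Rightarrow> (real^'n \<Rightarrow> real) \<Rightarrow> (real^'n \<Rightarrow> real)
     \<Rightarrow> (real^'n \<Rightarrow> complex) set" where
  "weak_amalgam p s \<alpha> w \<mu> =
     {f. f \<in> borel_measurable lebesgue \<and> weak_amalgam_norm p s \<alpha> w \<mu> f < \<infinity>}"

definition frac_kernel :: "real \<Rightarrow> (real^'n \<Rightarrow> complex) \<Rightarrow> real^'n \<Rightarrow> real^'n \<Rightarrow> complex" where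
  "frac_kernel \<gamma> f x y = f y / complex_of_real (norm (x - y) powr (real CARD('n) - \<gamma>))"

definition riesz_const :: "'n::finite itself \<Rightarrow> real \<Rightarrow> real" where
  "riesz_const _ \<gamma> =
     pi powr (real CARD('n) / 2) * 2 powr \<gamma> * Gamma (\<gamma> / 2) / Gamma ((real CARD('n) - \<gamma>) / 2)"

text \<open>At points where the integral does not converge absolutely the value below is \<open>0\<close>;
  \<open>frac_integral_defined\<close> says that this does not happen at \<open>x\<close>.\<close>

definition frac_integral :: "real \<Rightarrow> (real^'n \<Rightarrow> complex) \<Rightarrow> real^'n \<Rightarrow> complex" where
  "frac_integral \<gamma> f x =
     complex_of_real (1 / riesz_const TYPE('n) \<gamma>) * (\<integral>y. frac_kernel \<gamma> f x y \<partial>lebesgue)"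

definition frac_integral_defined :: "real \<Rightarrow> (real^'n \<Rightarrow> complex) \<Rightarrow> real^'n \<Rightarrow> bool" where
  "frac_integral_defined \<gamma> f x \<longleftrightarrow> integrable lebesgue (frac_kernel \<gamma> f x)"

end

theory Submission
  imports Defs
begin

text \<open>
  Write \<open>W = w\<^sup>q\<close>, a Muckenhoupt \<open>A\<^sub>1\<close> weight, and \<open>\<kappa> = 1 / q\<close>. For a subset \<open>E\<close> of a ball
  \<open>B = B(y, r)\<close> on which \<open>\<bar>I\<^sub>\<gamma> f\<bar> > t\<close>, Tonelli's theorem bounds \<open>t W(E)\<close> by the integral of \<open>\<bar>f\<bar>\<close>
  against \<open>h(z) = \<integral>\<^sub>E \<bar>x - z\<bar> powr (\<gamma> - n) W(x) dx\<close>. The pointwise form of \<open>A\<^sub>1\<close> gives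
  \<open>h(z) \<le> K w(z) W(E) powr (1 - \<kappa>)\<close> for almost every \<open>z\<close>, which is used on \<open>2B\<close>; on the shell between
  \<open>2\<^sup>k B\<close> and \<open>2\<^sup>k\<^sup>+\<^sup>1 B\<close> the kernel is at most a constant times \<open>(2\<^sup>k r) powr (\<gamma> - n)\<close>, and \<open>A\<^sub>1\<close> compares
  the integral of \<open>\<bar>f\<bar>\<close> over \<open>2\<^sup>k\<^sup>+\<^sup>1 B\<close> with that of \<open>\<bar>f\<bar> w\<close>. Together, with
  \<open>B\<^sub>k = 2\<^sup>k\<^sup>+\<^sup>1 B\<close>, \<open>t W(E) powr \<kappa>\<close> is at most a constant times
  \<open>\<Sum>k. (W(B) / W(B\<^sub>k)) powr \<kappa> * (\<integral> over B\<^sub>k of \<bar>f\<bar> w)\<close>.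
  The exponents of \<open>W(B(y, r))\<close> in the two amalgam norms agree; call them \<open>\<epsilon>\<close>. Since
  \<open>\<epsilon> + \<kappa> = 1 / \<beta> - 1 / s > 0\<close>, multiplication by \<open>W(B) powr \<epsilon>\<close> and reverse doubling of \<open>W\<close> turn the
  series into one with geometric coefficients, whose \<open>k\<close>-th term is the integrand of the amalgam
  norm of \<open>f\<close> at radius \<open>2\<^sup>k\<^sup>+\<^sup>1 r\<close>.
\<close>

section \<open>Lebesgue measure and extended powers\<close>

text \<open>Tonelli's theorem and the measurability of parametrised integrals are applied to the
  completed measure itself, and both ask for sigma-finiteness.\<close>

lemma sigma_finite_lebesgue: "sigma_finite_measure (lebesgue :: 'a::euclidean_space measure)"
proof (rule sigma_finite_measure.intro, intro exI conjI)
  let ?A = "range (\<lambda>n::nat. ball (0::'a) (real n))"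
  show "countable ?A" "?A \<subseteq> sets lebesgue" by auto
  show "\<Union>?A = space lebesgue"
    by (auto simp: reals_Archimedean2)
  show "\<forall>a\<in>?A. emeasure lebesgue a \<noteq> \<infinity>"
    by (auto simp: emeasure_ball)
qed

interpretation lebesgue: sigma_finite_measure "lebesgue :: 'a::euclidean_space measure"
  by (rule sigma_finite_lebesgue)

interpretation lebesgue_pair: pair_sigma_finite
  "lebesgue :: 'a::euclidean_space measure" "lebesgue :: 'b::euclidean_space measure" ..

lemma measurable_ident_lebesgue [measurable]:
  "(\<lambda>x. x) \<in> borel_measurable (lebesgue :: 'a::euclidean_space measure)"
  by (rule measurable_completion) simp

lemma measurable_fst_lebesgue [measurable]:
  "fst \<in> borel_measurable
     ((lebesgue :: 'a::euclidean_space measure) \<Otimes>\<^sub>M (lebesgue :: 'b::euclidean_space measure))"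
  by (rule measurable_compose[OF measurable_fst measurable_ident_lebesgue])

lemma measurable_snd_lebesgue [measurable]:
  "snd \<in> borel_measurable
     ((lebesgue :: 'a::euclidean_space measure) \<Otimes>\<^sub>M (lebesgue :: 'b::euclidean_space measure))"
  by (rule measurable_compose[OF measurable_snd measurable_ident_lebesgue])

text \<open>Membership in \<open>ball y r\<close> is a condition on \<open>dist y x\<close>, so the
  integrand is jointly measurable in centre and point. The outer norm integrates over the
  centre.\<close>

lemma borel_measurable_nn_integral_ball:
  fixes h :: "'a::euclidean_space \<Rightarrow> ennreal"
  assumes [measurable]: "h \<in> borel_measurable lebesgue"
  shows "(\<lambda>y. \<integral>\<^sup>+x\<in>ball y r. h x \<partial>lebesgue) \<in> borel_measurable lebesgue"
proof -
  have "(\<lambda>p. h (snd p) * indicator {..<r} (dist (fst p) (snd p)))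
     \<in> borel_measurable (lebesgue \<Otimes>\<^sub>M lebesgue)"
    by measurable
  then have "(\<lambda>y. \<integral>\<^sup>+x. h x * indicator {..<r} (dist y x) \<partial>lebesgue) \<in> borel_measurable lebesgue"
    by (intro lebesgue.borel_measurable_nn_integral) (simp add: case_prod_unfold)
  then show ?thesis by (simp add: indicator_def mem_ball)
qed

section \<open>Powers of extended non-negative reals\<close>

lemma epowr_mono:
  assumes "0 < a" and "x \<le> y"
  shows "x epowr a \<le> y epowr a"
proof (cases "x = 0 \<or> y = \<infinity>")
  case False
  with assms have "x < \<infinity>" "y < \<infinity>" "x \<noteq> 0" "y \<noteq> 0"
    by (auto simp: less_top top_unique)
  then show ?thesis using assms
    by (auto simp: epowr_def intro!: ennreal_leI powr_mono2 enn2real_mono)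
qed (use assms in \<open>auto simp: epowr_def\<close>)

lemma epowr_ennreal: "0 < v \<Longrightarrow> ennreal v epowr a = ennreal (v powr a)"
  by (auto simp: epowr_def)

lemma epowr_mult_ennreal:
  assumes "0 < a" "0 < c"
  shows "(ennreal c * x) epowr a = ennreal (c powr a) * x epowr a"
proof (cases "x = 0 \<or> x = \<infinity>")
  case True
  with assms show ?thesis by (auto simp: epowr_def ennreal_mult_eq_top_iff ennreal_top_mult ennreal_mult_top)
next
  case False
  then obtain v where "x = ennreal v" "0 < v"
    by (metis ennreal_cases ennreal_0 infinity_ennreal_def less_eq_real_def)
  with assms show ?thesis
    by (simp add: epowr_ennreal powr_mult flip: ennreal_mult)
qed

lemma epowr_inverse:
  assumes "0 < a"
  shows "(x epowr a) epowr (1 / a) = x"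
proof (cases "x = 0 \<or> x = \<infinity>")
  case True
  with assms show ?thesis by (auto simp: epowr_def)
next
  case False
  then obtain v where "x = ennreal v" "0 < v"
    by (metis ennreal_cases ennreal_0 infinity_ennreal_def less_eq_real_def)
  with assms show ?thesis
    by (simp add: epowr_ennreal powr_powr)
qed

lemma epowr_inverse':
  assumes "0 < a"
  shows "(x epowr (1 / a)) epowr a = x"
  using epowr_inverse[of "1 / a" x] assms by simp

lemma epowr_one [simp]: "x epowr 1 = x"
  using epowr_inverse[of 1] by (metis div_by_1 epowr_def ennreal_enn2real infinity_ennreal_def
      less_top powr_one enn2real_nonneg zero_less_one zero_neq_one)

lemma epowr_eq_0_iff: "0 < a \<Longrightarrow> x epowr a = 0 \<longleftrightarrow> x = 0"
  using epowr_inverse[of a x] by (auto simp: epowr_def)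

lemma borel_measurable_epowr [measurable]:
  "(\<lambda>x. x epowr a) \<in> borel_measurable borel"
  unfolding epowr_def by measurable

text \<open>A summable geometric factor is split off as \<open>sqrt \<theta> ^ k * sqrt \<theta> ^ k\<close>; this crude form of
  Minkowski's inequality is all that the \<open>L\<^sup>s(\<mu>)\<close> norm of the series over dilated balls needs.\<close>

lemma suminf_geometric_epowr_le:
  fixes G :: "nat \<Rightarrow> ennreal"
  assumes "0 < \<theta>" "\<theta> < 1" "0 < p"
  shows "(\<Sum>k. ennreal (\<theta> ^ k) * G k) epowr p
     \<le> ennreal ((1 / (1 - sqrt \<theta>)) powr p) * (\<Sum>k. ennreal ((sqrt \<theta> powr p) ^ k) * G k epowr p)"
proof -
  define \<rho> where "\<rho> = sqrt \<theta>"
  have \<rho>: "0 < \<rho>" "\<rho> < 1" "\<theta> = \<rho> * \<rho>" using assms by (auto simp: \<rho>_def)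
  define T where "T = (\<Sum>k. ennreal ((\<rho> powr p) ^ k) * G k epowr p)"
  have eq: "ennreal ((\<rho> powr p) ^ k) * G k epowr p = (ennreal (\<rho> ^ k) * G k) epowr p" for k
    using \<rho> assms by (simp add: epowr_mult_ennreal powr_power powr_realpow flip: powr_realpow)
     (simp add: powr_powr mult.commute)
  \<comment> \<open>One term of \<open>T\<close> is at most \<open>T\<close>. After the
    \<open>p\<close>-th root all terms are bounded by the same number, and only a geometric series
    is left to sum.\<close>
  have le: "ennreal (\<rho> ^ k) * G k \<le> T epowr (1 / p)" for k
  proof -
    have "(ennreal (\<rho> ^ k) * G k) epowr p \<le> T"
      unfolding T_def eq by (rule sum_le_suminf[of _ "{k}", simplified]) auto
    from epowr_mono[OF _ this, of "1/p"] show ?thesis using assms by (simp add: epowr_inverse)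
  qed
  have "(\<Sum>k. ennreal (\<theta> ^ k) * G k) \<le> (\<Sum>k. ennreal (\<rho> ^ k) * T epowr (1 / p))"
  proof (rule suminf_le)
    fix k
    have "ennreal (\<theta> ^ k) * G k = ennreal (\<rho> ^ k) * (ennreal (\<rho> ^ k) * G k)"
      using \<rho> by (simp add: power_mult_distrib ennreal_mult mult.assoc)
    also have "\<dots> \<le> ennreal (\<rho> ^ k) * T epowr (1 / p)" by (intro mult_left_mono le) simp
    finally show "ennreal (\<theta> ^ k) * G k \<le> ennreal (\<rho> ^ k) * T epowr (1 / p)" .
  qed auto
  also have "\<dots> = (\<Sum>k. ennreal (\<rho> ^ k)) * T epowr (1 / p)" by simp
  also have "(\<Sum>k. ennreal (\<rho> ^ k)) = ennreal (1 / (1 - \<rho>))"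
    using \<rho> by (intro suminf_ennreal_eq geometric_sums) auto
  finally have "(\<Sum>k. ennreal (\<theta> ^ k) * G k) epowr p
      \<le> (ennreal (1 / (1 - \<rho>)) * T epowr (1 / p)) epowr p"
    using assms by (intro epowr_mono)
  also have "\<dots> = ennreal ((1 / (1 - \<rho>)) powr p) * T"
    using assms \<rho> by (subst epowr_mult_ennreal) (auto simp: epowr_inverse')
  finally show ?thesis by (simp add: T_def \<rho>_def)
qed

section \<open>Outer and weak norms\<close>

text \<open>The essential supremum of a non-measurable function is \<open>top\<close>; this is why
  \<open>G\<close> must be measurable when \<open>s = \<infinity>\<close>.\<close>

lemma Ls_norm_mono:
  assumes "\<And>y. G y \<le> H y" and "s \<noteq> 0"
    and "s = \<infinity> \<Longrightarrow> G \<in> borel_measurable lebesgue"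
  shows "Ls_norm s \<mu> G \<le> Ls_norm s \<mu> H"
proof (cases "s = \<infinity>")
  case True
  then show ?thesis using assms by (auto simp: Ls_norm_def intro!: esssup_mono)
next
  case False
  with assms have "0 < enn2real s" by (simp add: enn2real_positive_iff less_top zero_less_iff_neq_zero)
  with False show ?thesis
    by (auto simp: Ls_norm_def intro!: epowr_mono nn_integral_mono mult_right_mono assms)
qed

lemma Ls_norm_cmult_le:
  assumes [measurable]: "G \<in> borel_measurable lebesgue" "\<mu> \<in> borel_measurable lebesgue"
    and "0 < K" and "s \<noteq> 0"
  shows "Ls_norm s \<mu> (\<lambda>y. ennreal K * G y) \<le> ennreal K * Ls_norm s \<mu> G"
proof (cases "s = \<infinity>")
  case True
  have "AE y in density lebesgue (\<lambda>y. ennreal (\<mu> y)). ennreal K * G y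
      \<le> ennreal K * esssup (density lebesgue (\<lambda>y. ennreal (\<mu> y))) G"
    using esssup_AE[where M="density lebesgue (\<lambda>y. ennreal (\<mu> y))" and f=G]
    by eventually_elim (auto intro: mult_left_mono)
  with True show ?thesis by (auto simp: Ls_norm_def intro!: esssup_I)
next
  case False
  define p where "p = enn2real s"
  have p: "0 < p" using False assms
    by (simp add: p_def enn2real_positive_iff less_top zero_less_iff_neq_zero)
  have "(\<integral>\<^sup>+y. (ennreal K * G y) epowr p * ennreal (\<mu> y) \<partial>lebesgue)
      = ennreal (K powr p) * (\<integral>\<^sup>+y. G y epowr p * ennreal (\<mu> y) \<partial>lebesgue)"
    using p \<open>0 < K\<close> by (subst nn_integral_cmult[symmetric])
      (auto simp: epowr_mult_ennreal mult.assoc)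
  then show ?thesis using False p \<open>0 < K\<close>
    by (simp add: Ls_norm_def p_def[symmetric] epowr_mult_ennreal powr_powr)
qed

text \<open>The constant \<open>D\<close> is fixed before \<open>G\<close> and \<open>N\<close>, so
  that one constant later serves every function and every radius. For \<open>s = \<infinity>\<close>
  countably many null sets are united; for finite \<open>s\<close> the powers are integrated term by
  term.\<close>

lemma Ls_norm_geometric_series:
  fixes \<mu> :: "real^'n \<Rightarrow> real"
  assumes \<theta>: "0 < \<theta>" "\<theta> < 1" and "s \<noteq> 0"
    and [measurable]: "\<mu> \<in> borel_measurable lebesgue"
  obtains D :: real where "0 < D"
    "\<And>G N. (\<And>k. G k \<in> borel_measurable lebesgue) \<Longrightarrow> (\<And>k. Ls_norm s \<mu> (G k) \<le> N) \<Longrightarrow>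
        Ls_norm s \<mu> (\<lambda>y. \<Sum>k. ennreal (\<theta> ^ k) * G k y) \<le> ennreal D * N"
proof (cases "s = \<infinity>")
  case True
  let ?M = "density lebesgue (\<lambda>y. ennreal (\<mu> y))"
  show ?thesis
  proof (rule that)
    show "0 < 1 / (1 - \<theta>)" using \<theta> by simp
    fix G :: "nat \<Rightarrow> real^'n \<Rightarrow> ennreal" and N
    assume [measurable]: "\<And>k. G k \<in> borel_measurable lebesgue"
      and N: "\<And>k. Ls_norm s \<mu> (G k) \<le> N"
    have "AE y in ?M. G k y \<le> N" for k
      using esssup_AE[where M="?M" and f="G k"] N[of k] True by (auto simp: Ls_norm_def elim!: eventually_mono)
    then have "AE y in ?M. \<forall>k. G k y \<le> N" unfolding AE_all_countable by blast
    then have "AE y in ?M. (\<Sum>k. ennreal (\<theta> ^ k) * G k y) \<le> ennreal (1 / (1 - \<theta>)) * N"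
    proof eventually_elim
      case (elim y)
      then have "(\<Sum>k. ennreal (\<theta> ^ k) * G k y) \<le> (\<Sum>k. ennreal (\<theta> ^ k) * N)"
        by (intro suminf_le mult_left_mono) auto
      also have "\<dots> = (\<Sum>k. ennreal (\<theta> ^ k)) * N" by simp
      also have "(\<Sum>k. ennreal (\<theta> ^ k)) = ennreal (1 / (1 - \<theta>))"
        using \<theta> by (intro suminf_ennreal_eq geometric_sums) auto
      finally show ?case .
    qed
    then show "Ls_norm s \<mu> (\<lambda>y. \<Sum>k. ennreal (\<theta> ^ k) * G k y) \<le> ennreal (1 / (1 - \<theta>)) * N"
      using True by (auto simp: Ls_norm_def intro!: esssup_I)
  qed
next
  case False
  define p where "p = enn2real s"
  have p: "0 < p" using False assms
    by (simp add: p_def enn2real_positive_iff less_top zero_less_iff_neq_zero)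
  define c where "c = (1 / (1 - sqrt \<theta>)) powr p"
  \<comment> \<open>This is the ratio of the geometric series that survives in
    \<open>suminf_geometric_epowr_le\<close> after taking powers.\<close>
  define \<sigma> where "\<sigma> = sqrt \<theta> powr p"
  have c: "0 < c" using \<theta> by (simp add: c_def)
  have \<sigma>: "0 < \<sigma>" "\<sigma> < 1" using \<theta> p powr_less_mono2[of p "sqrt \<theta>" 1] by (auto simp: \<sigma>_def)
  show ?thesis
  proof (rule that)
    show "0 < (c * (1 / (1 - \<sigma>))) powr (1 / p)" using c \<sigma> by simp
    fix G :: "nat \<Rightarrow> real^'n \<Rightarrow> ennreal" and N
    assume [measurable]: "\<And>k. G k \<in> borel_measurable lebesgue"
      and N: "\<And>k. Ls_norm s \<mu> (G k) \<le> N"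
    have Np: "(\<integral>\<^sup>+y. G k y epowr p * ennreal (\<mu> y) \<partial>lebesgue) \<le> N epowr p" for k
    proof -
      have "(\<integral>\<^sup>+y. G k y epowr p * ennreal (\<mu> y) \<partial>lebesgue) = Ls_norm s \<mu> (G k) epowr p"
        using False p by (simp add: Ls_norm_def p_def[symmetric] epowr_inverse')
      also have "\<dots> \<le> N epowr p" by (intro epowr_mono p N)
      finally show ?thesis .
    qed
    have "(\<integral>\<^sup>+y. (\<Sum>k. ennreal (\<theta> ^ k) * G k y) epowr p * ennreal (\<mu> y) \<partial>lebesgue)
       \<le> (\<integral>\<^sup>+y. ennreal c * (\<Sum>k. ennreal (\<sigma> ^ k) * G k y epowr p) * ennreal (\<mu> y) \<partial>lebesgue)"
      unfolding c_def \<sigma>_def using \<theta> p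
      by (intro nn_integral_mono mult_right_mono suminf_geometric_epowr_le) auto
    also have "\<dots> = (\<integral>\<^sup>+y. ennreal c * (\<Sum>k. ennreal (\<sigma> ^ k) * (G k y epowr p * ennreal (\<mu> y))) \<partial>lebesgue)"
      by (simp add: mult.assoc flip: ennreal_suminf_multc)
    also have "\<dots> = ennreal c * (\<Sum>k. ennreal (\<sigma> ^ k) * (\<integral>\<^sup>+y. G k y epowr p * ennreal (\<mu> y) \<partial>lebesgue))"
      by (subst nn_integral_cmult; (subst nn_integral_suminf)?; (subst nn_integral_cmult)?; simp)
    also have "\<dots> \<le> ennreal c * (\<Sum>k. ennreal (\<sigma> ^ k) * N epowr p)"
      by (intro mult_left_mono suminf_le Np) auto
    also have "\<dots> = ennreal c * ((\<Sum>k. ennreal (\<sigma> ^ k)) * N epowr p)" by simp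
    also have "(\<Sum>k. ennreal (\<sigma> ^ k)) = ennreal (1 / (1 - \<sigma>))"
      using \<sigma> by (intro suminf_ennreal_eq geometric_sums) auto
    also have "ennreal c * (ennreal (1 / (1 - \<sigma>)) * N epowr p)
        = ennreal (c * (1 / (1 - \<sigma>))) * N epowr p"
      using c \<sigma> by (subst ennreal_mult) (auto simp: mult.assoc)
    finally have "(\<integral>\<^sup>+y. (\<Sum>k. ennreal (\<theta> ^ k) * G k y) epowr p * ennreal (\<mu> y) \<partial>lebesgue) epowr (1 / p)
        \<le> (ennreal (c * (1 / (1 - \<sigma>))) * N epowr p) epowr (1 / p)"
      using p by (intro epowr_mono) auto
    also have "\<dots> = ennreal ((c * (1 / (1 - \<sigma>))) powr (1 / p)) * N"
      using p c \<sigma> by (subst epowr_mult_ennreal) (auto simp: epowr_inverse)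
    finally show "Ls_norm s \<mu> (\<lambda>y. \<Sum>k. ennreal (\<theta> ^ k) * G k y)
        \<le> ennreal ((c * (1 / (1 - \<sigma>))) powr (1 / p)) * N"
      using False by (simp add: Ls_norm_def p_def[symmetric])
  qed
qed

text \<open>Since \<open>\<infinity> * 0 = 0\<close>, an infinite value costs nothing where
  \<open>\<mu>\<close> vanishes, so finiteness can be claimed only where \<open>\<mu>\<close> is
  positive.\<close>

lemma Ls_norm_finite_imp_AE_finite:
  assumes [measurable]: "G \<in> borel_measurable lebesgue" "\<mu> \<in> borel_measurable lebesgue"
    and "s \<noteq> 0" and fin: "Ls_norm s \<mu> G < \<infinity>"
  shows "AE y in lebesgue. 0 < \<mu> y \<longrightarrow> G y < \<infinity>"
proof (cases "s = \<infinity>")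
  case True
  have "AE y in density lebesgue (\<lambda>y. ennreal (\<mu> y)). G y < \<infinity>"
    using esssup_AE[where M="density lebesgue (\<lambda>y. ennreal (\<mu> y))" and f=G] fin True
    by (auto simp: Ls_norm_def elim!: eventually_mono)
  then show ?thesis by (subst (asm) AE_density) auto
next
  case False
  define p where "p = enn2real s"
  have p: "0 < p" using False assms
    by (simp add: p_def enn2real_positive_iff less_top zero_less_iff_neq_zero)
  have "(\<integral>\<^sup>+y. G y epowr p * ennreal (\<mu> y) \<partial>lebesgue) \<noteq> \<infinity>"
    using fin False p by (auto simp: Ls_norm_def p_def[symmetric] epowr_def split: if_splits)
  then have "AE y in lebesgue. G y epowr p * ennreal (\<mu> y) \<noteq> \<infinity>"
    by (intro nn_integral_PInf_AE) auto
  then show ?thesis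
    by eventually_elim (use p in \<open>auto simp: epowr_def ennreal_top_mult less_top split: if_splits\<close>)
qed

text \<open>A countable supremum is visibly measurable in a parameter. Level sets shrink as the
  level grows, so a rational \<open>v\<close> between \<open>u\<close> and \<open>t\<close> does at
  least as well as \<open>u\<close> times the measure at level \<open>t\<close>; then
  \<open>u\<close> tends to \<open>t\<close>.\<close>

lemma weak_Lp_norm_eq_rational:
  assumes "0 < p"
  shows "weak_Lp_norm p w g
    = (SUP t\<in>{t. t \<in> \<rat> \<and> 0 < t}. ennreal t * wmeas w {x. norm (g x) > t} epowr (1 / p))"
    (is "_ = ?R")
  unfolding weak_Lp_norm_def
proof (intro antisym SUP_least)
  fix t :: real assume "t \<in> {0<..}"
  then have t: "0 < t" by simp
  define D where "D = wmeas w {x. norm (g x) > t} epowr (1 / p)"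
  have "ennreal u * D \<le> ?R" if u: "0 < u" "u < t" for u
  proof -
    from u obtain v where v: "v \<in> \<rat>" "u < v" "v < t" using Rats_dense_in_real by blast
    have "ennreal u * D \<le> ennreal v * wmeas w {x. norm (g x) > v} epowr (1 / p)"
      unfolding D_def wmeas_def using u v assms
      by (intro mult_mono epowr_mono nn_integral_mono ennreal_leI) (auto simp: indicator_def)
    also have "\<dots> \<le> ?R" using u v by (intro SUP_upper) auto
    finally show ?thesis .
  qed
  \<comment> \<open>The shift by 2 keeps the factor strictly positive already at
    \<open>n = 0\<close>.\<close>
  then have "\<forall>n::nat. ennreal (t * (1 - 1 / real (n + 2))) * D \<le> ?R"
    using t by (auto simp: divide_simps)
  moreover have "(\<lambda>n::nat. ennreal (t * (1 - 1 / real (n + 2)))) \<longlonglongrightarrow> ennreal (t * (1 - 0))"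
    by (intro tendsto_intros LIMSEQ_ignore_initial_segment[OF lim_1_over_n])
  then have "(\<lambda>n::nat. ennreal (t * (1 - 1 / real (n + 2))) * D) \<longlonglongrightarrow> ennreal (t * (1 - 0)) * D"
    using t by (intro tendsto_mult_ennreal) auto
  ultimately show "ennreal t * D \<le> ?R"
    by (auto intro: LIMSEQ_le_const2)
next
  fix t :: real assume "t \<in> {t. t \<in> \<rat> \<and> 0 < t}"
  then show "ennreal t * wmeas w {x. norm (g x) > t} epowr (1 / p)
      \<le> (SUP t\<in>{0<..}. ennreal t * wmeas w {x. norm (g x) > t} epowr (1 / p))"
    by (intro SUP_upper) auto
qed

lemma borel_measurable_weak_Lp_norm_ball:
  fixes g :: "real^'n \<Rightarrow> complex"
  assumes [measurable]: "g \<in> borel_measurable lebesgue" "w \<in> borel_measurable lebesgue" and "0 < p"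
  shows "(\<lambda>y. weak_Lp_norm p w (restr (ball y r) g)) \<in> borel_measurable lebesgue"
proof -
  \<comment> \<open>A positive level excludes the points outside the ball, where
    \<open>restr\<close> is 0.\<close>
  have eq: "wmeas w {x. norm (restr (ball y r) g x) > t}
      = (\<integral>\<^sup>+x\<in>ball y r. ennreal (w x) * indicator {x. norm (g x) > t} x \<partial>lebesgue)"
    if "0 < t" for y t
    unfolding wmeas_def using that by (intro nn_integral_cong) (auto simp: restr_def indicator_def)
  have [measurable]: "{x. norm (g x) > t} \<in> sets lebesgue" for t
    using measurable_sets[OF measurable_compose[OF assms(1) borel_measurable_norm], of "{t<..}"]
    by (simp add: vimage_def)
  have [measurable]: "(\<lambda>y. \<integral>\<^sup>+x\<in>ball y r. ennreal (w x) * indicator {x. norm (g x) > t} x \<partial>lebesgue)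
     \<in> borel_measurable lebesgue" for t
    by (intro borel_measurable_nn_integral_ball) measurable
  have "countable {t. t \<in> \<rat> \<and> 0 < (t::real)}"
    by (rule countable_subset[OF _ countable_rat]) auto
  then have "(\<lambda>y. SUP t\<in>{t. t \<in> \<rat> \<and> 0 < t}.
      ennreal t * (\<integral>\<^sup>+x\<in>ball y r. ennreal (w x) * indicator {x. norm (g x) > t} x \<partial>lebesgue) epowr (1 / p))
     \<in> borel_measurable lebesgue"
    by measurable
  then show ?thesis
    by (rule measurable_cong[THEN iffD1, rotated])
      (auto simp: weak_Lp_norm_eq_rational[OF \<open>0 < p\<close>] eq intro!: SUP_cong)
qed

section \<open>Muckenhoupt weights\<close>

lemma emeasure_lborel_ball_powr:
  fixes y :: "real^'n"
  assumes "0 < r"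
  shows "emeasure lborel (ball y r)
    = ennreal (unit_ball_vol (real CARD('n)) * r powr real CARD('n))"
  using assms by (simp add: emeasure_ball powr_realpow)

lemma unit_ball_vol_CARD_pos: "0 < unit_ball_vol (real CARD('n::finite))"
  by (simp add: unit_ball_vol_pos)

text \<open>\<open>A1\<close> is the pointwise Muckenhoupt condition, with the volume of the unit
  ball absorbed in \<open>C\<close>. The zero weight satisfies it too and is excluded by
  \<open>not_AE_zero\<close>, so that balls get positive mass.\<close>

locale A1_weight =
  fixes W :: "real^'n \<Rightarrow> real" and C :: real
  assumes W_nonneg: "0 \<le> W x"
    and W_measurable [measurable]: "W \<in> borel_measurable lebesgue"
    and C_pos: "0 < C"
    and finite_ball: "0 < r \<Longrightarrow> wmeas W (ball y r) < \<infinity>"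
    and A1: "0 < r \<Longrightarrow>
      AE x in lebesgue. x \<in> ball y r \<longrightarrow>
        wmeas W (ball y r) \<le> ennreal (C * r powr real CARD('n) * W x)"
    and not_AE_zero: "\<not> (AE x in lebesgue. W x = 0)"
begin

lemma wmeas_eq_emeasure:
  "E \<in> sets lebesgue \<Longrightarrow> wmeas W E = emeasure (density lebesgue (\<lambda>x. ennreal (W x))) E"
  by (simp add: wmeas_def emeasure_density)

lemma wmeas_mono: "E \<subseteq> F \<Longrightarrow> wmeas W E \<le> wmeas W F"
  unfolding wmeas_def by (intro nn_integral_mono) (auto simp: indicator_def)

text \<open>Integrating \<open>A1\<close> over \<open>E\<close> compares the share of
  \<open>E\<close> in the volume of the ball with its share in the \<open>W\<close>-mass. Positivity
  of balls, doubling and reverse doubling are all read off from this.\<close>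

lemma emeasure_le_wmeas:
  assumes E[measurable]: "E \<in> sets lebesgue" and "E \<subseteq> ball y r" and "0 < r"
  shows "wmeas W (ball y r) * emeasure lebesgue E \<le> ennreal (C * r powr real CARD('n)) * wmeas W E"
proof -
  have "wmeas W (ball y r) * emeasure lebesgue E
      = (\<integral>\<^sup>+x\<in>E. wmeas W (ball y r) \<partial>lebesgue)"
    by (simp add: nn_integral_cmult_indicator)
  also have "\<dots> \<le> (\<integral>\<^sup>+x\<in>E. ennreal (C * r powr real CARD('n)) * ennreal (W x) \<partial>lebesgue)"
  proof (rule nn_integral_mono_AE)
    show "AE x in lebesgue. wmeas W (ball y r) * indicator E x
       \<le> ennreal (C * r powr real CARD('n)) * ennreal (W x) * indicator E x"
      using A1[OF \<open>0 < r\<close>, of y]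
      by eventually_elim
        (use assms(2) C_pos W_nonneg in \<open>auto simp: indicator_def ennreal_mult\<close>)
  qed
  also have "\<dots> = ennreal (C * r powr real CARD('n)) * wmeas W E"
    unfolding wmeas_def by (subst nn_integral_cmult[symmetric]) (auto simp: mult.assoc)
  finally show ?thesis .
qed

text \<open>If one ball had mass zero, the comparison with \<open>E\<close> equal to that ball would
  make every larger concentric ball null, and \<open>W\<close> would vanish almost
  everywhere.\<close>

lemma wmeas_ball_pos:
  assumes "0 < r"
  shows "0 < wmeas W (ball y r)"
proof (rule ccontr)
  assume "\<not> 0 < wmeas W (ball y r)"
  then have 0: "wmeas W (ball y r) = 0" by (simp add: not_less)
  have "AE x in lebesgue. x \<in> ball y (r + real m) \<longrightarrow> W x = 0" for m :: nat
  proof -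
    have "wmeas W (ball y (r + real m)) * emeasure lebesgue (ball y r) \<le> 0"
      using emeasure_le_wmeas[of "ball y r" y "r + real m"] assms 0
      by (simp add: subset_ball)
    moreover have "0 < unit_ball_vol (real CARD('n)) * r powr real CARD('n)"
      using assms by (simp add: unit_ball_vol_pos)
    ultimately have "wmeas W (ball y (r + real m)) = 0"
      using assms unit_ball_vol_CARD_pos[where 'n='n] by (auto simp: emeasure_lborel_ball_powr)
    then show ?thesis
      unfolding wmeas_def using W_nonneg
      by (subst (asm) nn_integral_0_iff_AE)
        (auto elim!: eventually_mono simp: indicator_def antisym ennreal_eq_0_iff split: if_splits)
  qed
  then have "AE x in lebesgue. \<forall>m. x \<in> ball y (r + real m) \<longrightarrow> W x = 0"
    unfolding AE_all_countable by blast
  then have "AE x in lebesgue. W x = 0"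
  proof eventually_elim
    case (elim x)
    obtain m where "dist y x < real m" using reals_Archimedean2 by blast
    then have "x \<in> ball y (r + real m)" using assms by simp
    with elim show ?case by blast
  qed
  with not_AE_zero show False ..
qed

definition v :: "real^'n \<Rightarrow> real \<Rightarrow> real" where
  "v y r = enn2real (wmeas W (ball y r))"

lemma wmeas_ball: "0 < r \<Longrightarrow> wmeas W (ball y r) = ennreal (v y r)"
  using finite_ball[of r y] by (simp add: v_def)

lemma v_pos: "0 < r \<Longrightarrow> 0 < v y r"
  using wmeas_ball_pos[of r y] by (simp add: wmeas_ball)

lemma v_mono: "0 < r \<Longrightarrow> ball y r \<subseteq> ball z t \<Longrightarrow> 0 < t \<Longrightarrow> v y r \<le> v z t"
  using wmeas_mono[of "ball y r" "ball z t"] v_pos[of t z]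
  by (simp add: wmeas_ball)

lemma v_le_AE:
  assumes "0 < r"
  shows "AE x in lebesgue. x \<in> ball y r \<longrightarrow> v y r \<le> C * r powr real CARD('n) * W x"
  using A1[OF assms, of y]
proof eventually_elim
  case (elim x)
  then show ?case using assms C_pos W_nonneg[of x] by (simp add: wmeas_ball)
qed

text \<open>On each ball \<open>A1\<close> bounds \<open>W\<close> from below by a positive
  constant, and countably many balls cover the space.\<close>

lemma W_pos_AE: "AE x in lebesgue. 0 < W x"
proof -
  have "AE x in lebesgue. \<forall>m::nat. x \<in> ball 0 (real (Suc m)) \<longrightarrow>
      v 0 (real (Suc m)) \<le> C * real (Suc m) powr real CARD('n) * W x"
    unfolding AE_all_countable by (intro allI v_le_AE) simp
  then show ?thesis
  proof eventually_elim
    case (elim x)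
    obtain m where "norm x < real m" using reals_Archimedean2 by blast
    then have "x \<in> ball 0 (real (Suc m))" by simp
    with elim v_pos[of "real (Suc m)" 0]
    have "0 < C * real (Suc m) powr real CARD('n) * W x"
      by (meson less_le_trans of_nat_0_less_iff zero_less_Suc)
    then show ?case using C_pos W_nonneg[of x] by (auto simp: zero_less_mult_iff)
  qed
qed

text \<open>Both doubling and reverse doubling of \<open>W\<close> come from comparing \<open>W\<close> with Lebesgue measure
  on subsets of the larger ball: the smaller ball, respectively its complement.\<close>

lemma v_doubling:
  assumes "0 < r"
  shows "v y (2 * r) \<le> C * 2 powr real CARD('n) / unit_ball_vol (real CARD('n)) * v y r"
proof -
  let ?d = "real CARD('n)" and ?u = "unit_ball_vol (real CARD('n))"
  have "ennreal (v y (2 * r) * (?u * r powr ?d)) \<le> ennreal (C * (2 * r) powr ?d * v y r)"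
    using emeasure_le_wmeas[of "ball y r" y "2 * r"] assms v_pos[of r y] v_pos[of "2*r" y] C_pos
    by (simp add: subset_ball emeasure_lborel_ball_powr wmeas_ball ennreal_mult unit_ball_vol_pos less_imp_le)
  then have "v y (2 * r) * (?u * r powr ?d) \<le> C * (2 * r) powr ?d * v y r"
    using assms C_pos v_pos[of r y] by (subst (asm) ennreal_le_iff) auto
  then show ?thesis
    using assms unit_ball_vol_CARD_pos[where 'n='n] by (simp add: powr_mult field_simps)
qed

lemma v_reverse_doubling:
  obtains \<theta> where "0 < \<theta>" "\<theta> < 1" "\<And>y r k. 0 < r \<Longrightarrow> v y r \<le> \<theta> ^ k * v y (2 ^ k * r)"
proof -
  let ?d = "real CARD('n)" and ?u = "unit_ball_vol (real CARD('n))"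
  \<comment> \<open>The shell between the two balls has at least half the volume of the larger one,
    so \<open>emeasure_le_wmeas\<close> gives it at least the fraction \<open>c\<close> of the
    mass.\<close>
  define c where "c = ?u / (2 * C)"
  have u: "0 < ?u" by (simp add: unit_ball_vol_pos)
  have c: "0 < c" using u C_pos by (simp add: c_def)
  \<comment> \<open>The maximum makes \<open>\<theta>\<close> positive without an upper bound on
    \<open>c\<close>.\<close>
  define \<theta> where "\<theta> = max (1/2) (1 - c)"
  have \<theta>: "0 < \<theta>" "\<theta> < 1" using c by (auto simp: \<theta>_def)
  have step: "v y r \<le> \<theta> * v y (2 * r)" if r: "0 < r" for y r
  proof -
    let ?E = "ball y (2 * r) - ball y r"
    have sub: "ball y r \<subseteq> ball y (2 * r)" using r by (simp add: subset_ball)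
    have "emeasure lebesgue ?E = ennreal (?u * (2 * r) powr ?d) - ennreal (?u * r powr ?d)"
      using r u sub by (subst emeasure_Diff) (auto simp: emeasure_lborel_ball_powr)
    also have "\<dots> = ennreal (?u * (2 powr ?d - 1) * r powr ?d)"
      using r u by (subst ennreal_minus) (auto simp: powr_mult algebra_simps)
    finally have E: "emeasure lebesgue ?E = ennreal (?u * (2 powr ?d - 1) * r powr ?d)" .
    have "wmeas W ?E = wmeas W (ball y (2 * r)) - wmeas W (ball y r)"
      using sub finite_ball[OF r, of y]
      by (simp add: wmeas_eq_emeasure emeasure_Diff less_top)
    also have "\<dots> = ennreal (v y (2 * r) - v y r)"
      using r v_pos[OF r, of y] by (simp add: wmeas_ball ennreal_minus)
    finally have WE: "wmeas W ?E = ennreal (v y (2 * r) - v y r)" .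
    have vle: "v y r \<le> v y (2 * r)" using r sub by (intro v_mono) auto
    have d1: "1 \<le> ?d" by (simp add: Suc_leI)
    have "2 powr 1 \<le> (2::real) powr ?d" using d1 by (intro powr_mono) auto
    then have h: "2 powr ?d / 2 \<le> (2 powr ?d - 1 :: real)" by simp
    have "ennreal (v y (2 * r) * (?u * (2 powr ?d - 1) * r powr ?d))
       \<le> ennreal (C * (2 * r) powr ?d * (v y (2 * r) - v y r))"
      using emeasure_le_wmeas[of ?E y "2 * r"] r u C_pos v_pos[of "2 * r" y] h vle
      unfolding E WE by (simp add: wmeas_ball ennreal_mult)
    then have "v y (2 * r) * (?u * (2 powr ?d - 1) * r powr ?d)
       \<le> C * (2 * r) powr ?d * (v y (2 * r) - v y r)"
      using r C_pos vle by (subst (asm) ennreal_le_iff) auto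
    then have "v y (2 * r) * (?u * (2 powr ?d - 1)) \<le> C * 2 powr ?d * (v y (2 * r) - v y r)"
      using r mult_right_le_imp_le[of "v y (2 * r) * (?u * (2 powr ?d - 1))" "r powr ?d"
          "C * 2 powr ?d * (v y (2 * r) - v y r)"]
      by (simp add: powr_mult mult_ac)
    moreover have "v y (2 * r) * (?u * (2 powr ?d / 2)) \<le> v y (2 * r) * (?u * (2 powr ?d - 1))"
      using h u v_pos[of "2 * r" y] r by (intro mult_left_mono) auto
    ultimately have "v y (2 * r) * (?u * (2 powr ?d / 2)) \<le> C * 2 powr ?d * (v y (2 * r) - v y r)"
      by (rule order_trans[rotated])
    then have "(v y (2 * r) * ?u / 2) * 2 powr ?d \<le> (C * (v y (2 * r) - v y r)) * 2 powr ?d"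
      by (simp only: mult_ac times_divide_eq_right times_divide_eq_left)
    then have "v y (2 * r) * ?u / 2 \<le> C * (v y (2 * r) - v y r)"
      by (rule mult_right_le_imp_le) simp
    then have "c * v y (2 * r) \<le> v y (2 * r) - v y r"
      using C_pos by (simp add: c_def field_simps)
    then have "v y r \<le> (1 - c) * v y (2 * r)" by (simp add: algebra_simps)
    also have "\<dots> \<le> \<theta> * v y (2 * r)"
      using v_pos[of "2 * r" y] r by (intro mult_right_mono) (auto simp: \<theta>_def)
    finally show ?thesis .
  qed
  have "v y r \<le> \<theta> ^ k * v y (2 ^ k * r)" if "0 < r" for y r k
  proof (induction k)
    case (Suc k)
    have "v y (2 ^ k * r) \<le> \<theta> * v y (2 * (2 ^ k * r))"
      using that by (intro step) simp
    with Suc \<theta> have "v y r \<le> \<theta> ^ k * (\<theta> * v y (2 * (2 ^ k * r)))"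
      by (meson mult_left_mono order_trans zero_le_power less_imp_le)
    then show ?case by (simp add: mult_ac)
  qed simp
  with \<theta> that show ?thesis by blast
qed

text \<open>The null set in \<open>A1\<close> depends on the ball. Only countably many balls are
  used, with centres in a dense set and rational radii; each ball around \<open>y\<close> lies in
  one of them of less than twice its radius, which costs the factor \<open>2 powr n\<close>. A
  single null set then serves all radii.\<close>

lemma A1_pointwise:
  "AE y in lebesgue. \<forall>\<rho>>0. v y \<rho> \<le> C * 2 powr real CARD('n) * \<rho> powr real CARD('n) * W y"
proof -
  obtain D :: "(real^'n) set" where D: "countable D" "\<And>X. open X \<Longrightarrow> X \<noteq> {} \<Longrightarrow> \<exists>d\<in>D. d \<in> X"
    using countable_dense_setE by blast
  have "AE y in lebesgue. \<forall>c\<in>D. \<forall>t\<in>\<rat>. 0 < t \<longrightarrow> y \<in> ball c t \<longrightarrow>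
      v c t \<le> C * t powr real CARD('n) * W y"
  proof (intro AE_ball_countable[OF D(1), THEN iffD2] AE_ball_countable[OF countable_rat, THEN iffD2] ballI)
    fix c and t :: real
    show "AE y in lebesgue. 0 < t \<longrightarrow> y \<in> ball c t \<longrightarrow> v c t \<le> C * t powr real CARD('n) * W y"
      using v_le_AE[of t c] by (cases "0 < t") auto
  qed
  then show ?thesis
  proof eventually_elim
    case (elim y)
    show ?case
    proof (intro allI impI)
      fix \<rho> :: real assume \<rho>: "0 < \<rho>"
      obtain c where c: "c \<in> D" "c \<in> ball y (\<rho> / 2)"
        using D(2)[of "ball y (\<rho> / 2)"] \<rho> by auto
      \<comment> \<open>As \<open>c\<close> is within \<open>\<rho> / 2\<close> of \<open>y\<close>,
        a radius above \<open>3 / 2 * \<rho>\<close> is enough to contain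
        \<open>ball y \<rho>\<close>.\<close>
      obtain t where t: "t \<in> \<rat>" "3 / 2 * \<rho> < t" "t < 2 * \<rho>"
        using Rats_dense_in_real[of "3 / 2 * \<rho>" "2 * \<rho>"] \<rho> by auto
      have sub: "ball y \<rho> \<subseteq> ball c t"
      proof
        fix x assume "x \<in> ball y \<rho>"
        with c t dist_triangle[of c x y] show "x \<in> ball c t" by (simp add: dist_commute)
      qed
      have "v y \<rho> \<le> v c t" using \<rho> t sub by (intro v_mono) auto
      also have "\<dots> \<le> C * t powr real CARD('n) * W y"
        using elim c t \<rho> sub by (auto simp: subset_eq)
      also have "\<dots> \<le> C * (2 * \<rho>) powr real CARD('n) * W y"
        using t \<rho> C_pos W_nonneg by (intro mult_right_mono mult_left_mono powr_mono2) auto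
      also have "\<dots> = C * 2 powr real CARD('n) * \<rho> powr real CARD('n) * W y"
        using \<rho> by (simp add: powr_mult)
      finally show "v y \<rho> \<le> C * 2 powr real CARD('n) * \<rho> powr real CARD('n) * W y" .
    qed
  qed
qed

end

section \<open>Kernel estimates\<close>

lemma obtain_dyadic_shell_inside:
  fixes u R :: real
  assumes "0 < u" "u < R"
  obtains j :: nat where "R / 2 ^ Suc j \<le> u" "u < R / 2 ^ j"
proof -
  define N where "N = (LEAST N. R / 2 ^ N \<le> u)"
  obtain n where "R / u < 2 ^ n" using real_arch_pow[of 2 "R / u"] by auto
  then have "R / 2 ^ n \<le> u" using assms by (simp add: field_simps)
  then have N: "R / 2 ^ N \<le> u" unfolding N_def by (rule LeastI)
  then have "N \<noteq> 0" using assms by (intro notI) simp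
  then obtain j where j: "N = Suc j" by (cases N) auto
  have "\<not> R / 2 ^ j \<le> u" using not_less_Least[of j "\<lambda>N. R / 2 ^ N \<le> u"] j by (simp add: N_def)
  with N j that show ?thesis by auto
qed

lemma obtain_dyadic_shell_outside:
  fixes u R :: real
  assumes "0 < R" "R \<le> u"
  obtains k :: nat where "2 ^ k * R \<le> u" "u < 2 ^ Suc k * R"
proof -
  define N where "N = (LEAST N. u < 2 ^ N * R)"
  obtain n where "u / R < 2 ^ n" using real_arch_pow[of 2 "u / R"] by auto
  then have "u < 2 ^ n * R" using assms by (simp add: field_simps)
  then have N: "u < 2 ^ N * R" unfolding N_def by (rule LeastI)
  then have "N \<noteq> 0" using assms by (intro notI) simp
  then obtain k where k: "N = Suc k" by (cases N) auto
  have "\<not> u < 2 ^ k * R" using not_less_Least[of k "\<lambda>N. u < 2 ^ N * R"] k by (simp add: N_def)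
  with N k show ?thesis by (intro that[of k]) auto
qed

lemma ball_sets_lebesgue [measurable]: "ball y r \<in> sets (lebesgue :: 'a::euclidean_space measure)"
  by simp

lemma suminf_ennreal_split_first:
  fixes f :: "nat \<Rightarrow> ennreal"
  shows "(\<Sum>k. f k) = f 0 + (\<Sum>k. f (Suc k))"
proof -
  have "f sums ((\<Sum>k. f (Suc k)) + f 0)" by (intro sums_Suc summable_sums summableI)
  then show ?thesis by (simp add: sums_iff add.commute)
qed

locale A1_weight_frac = A1_weight W C for W :: "real^'n \<Rightarrow> real" and C +
  fixes \<gamma> :: real
  assumes \<gamma>_pos: "0 < \<gamma>" and \<gamma>_less: "\<gamma> < real CARD('n)"
begin

definition \<kappa> :: real where "\<kappa> = (real CARD('n) - \<gamma>) / real CARD('n)"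

text \<open>Because \<open>0 powr a = 0\<close>, the kernel is 0 on the diagonal, in agreement with
  division by zero in \<open>frac_kernel\<close>.\<close>

definition kern :: "real^'n \<Rightarrow> real^'n \<Rightarrow> real" where
  "kern x y = norm (x - y) powr (\<gamma> - real CARD('n))"

lemma \<kappa>: "0 < \<kappa>" "\<kappa> < 1" "1 - \<kappa> = \<gamma> / real CARD('n)" "real CARD('n) * \<kappa> = real CARD('n) - \<gamma>"
  using \<gamma>_pos \<gamma>_less by (auto simp: \<kappa>_def field_simps)

lemma kern_nonneg [simp]: "0 \<le> kern x y"
  by (simp add: kern_def)

lemma kern_le: "0 < R \<Longrightarrow> R \<le> norm (x - y) \<Longrightarrow> kern x y \<le> R powr (\<gamma> - real CARD('n))"
  unfolding kern_def using \<gamma>_less by (intro powr_mono2') auto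

lemma kern_measurable [measurable]:
  "(\<lambda>p. kern (fst p) (snd p)) \<in> borel_measurable (lebesgue \<Otimes>\<^sub>M lebesgue)"
  unfolding kern_def by measurable

lemma kern_measurable1 [measurable]: "(\<lambda>x. kern x y) \<in> borel_measurable lebesgue"
  unfolding kern_def by measurable

lemma kern_measurable2 [measurable]: "kern x \<in> borel_measurable lebesgue"
  unfolding kern_def by measurable

text \<open>Only the term whose dyadic shell contains \<open>x\<close> is needed. Replacing shells
  by full balls makes the terms integrate to ball masses of \<open>W\<close>.\<close>

lemma kern_ball_le:
  "ennreal (kern x y) * indicator (ball y R) x
    \<le> (\<Sum>j. ennreal ((R / 2 ^ Suc j) powr (\<gamma> - real CARD('n))) * indicator (ball y (R / 2 ^ j)) x)"
proof (cases "x \<noteq> y \<and> x \<in> ball y R")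
  case True
  then obtain j where j: "R / 2 ^ Suc j \<le> norm (x - y)" "norm (x - y) < R / 2 ^ j"
    using obtain_dyadic_shell_inside[of "norm (x - y)" R] by (auto simp: dist_norm norm_minus_commute)
  have "0 < R" using True zero_le_dist[of y x] unfolding mem_ball by linarith
  then have "kern x y \<le> (R / 2 ^ Suc j) powr (\<gamma> - real CARD('n))"
    using j by (intro kern_le) auto
  then have "ennreal (kern x y) * indicator (ball y R) x
     \<le> ennreal ((R / 2 ^ Suc j) powr (\<gamma> - real CARD('n))) * indicator (ball y (R / 2 ^ j)) x"
    using True j by (auto simp: dist_norm norm_minus_commute intro!: ennreal_leI)
  also have "\<dots> \<le> (\<Sum>j. ennreal ((R / 2 ^ Suc j) powr (\<gamma> - real CARD('n))) * indicator (ball y (R / 2 ^ j)) x)"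
    by (rule sum_le_suminf[of _ "{j}", simplified]) auto
  finally show ?thesis .
qed (auto simp: kern_def indicator_def)

text \<open>At radius \<open>t = R / 2 ^ j\<close> the kernel is of order
  \<open>t powr (\<gamma> - n)\<close> and the mass is at most a constant times
  \<open>t powr n * W y\<close>. The products are of order \<open>t powr \<gamma> * W y\<close> and
  sum geometrically, as \<open>\<gamma> > 0\<close>.\<close>

lemma kern_ball_integral_le:
  obtains K where "0 < K"
    "AE y in lebesgue. \<forall>R>0. (\<integral>\<^sup>+x\<in>ball y R. ennreal (kern x y) * ennreal (W x) \<partial>lebesgue)
        \<le> ennreal (K * R powr \<gamma> * W y)"
proof
  let ?d = "real CARD('n)"
  define \<sigma> where "\<sigma> = (1/2) powr \<gamma>"
  have \<sigma>: "0 < \<sigma>" "\<sigma> < 1"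
    using \<gamma>_pos powr_less_mono2[of \<gamma> "1/2" 1] by (auto simp: \<sigma>_def)
  have \<sigma>_pow: "\<sigma> ^ j = ((1/2) ^ j) powr \<gamma>" for j
    by (induction j) (simp_all add: \<sigma>_def flip: powr_mult)
  have two: "2 powr (?d - \<gamma>) = 1 / 2 powr (\<gamma> - ?d)"
    using powr_minus_divide[of 2 "\<gamma> - ?d"] by simp
  \<comment> \<open>\<open>C * 2 powr n\<close> comes from \<open>A1_pointwise\<close>; the last
    factor arises because the kernel is bounded at the inner radius of the shell, half the outer
    one.\<close>
  define c where "c = C * 2 powr ?d * 2 powr (?d - \<gamma>)"
  have c: "0 < c" using C_pos by (simp add: c_def)
  show "0 < c / (1 - \<sigma>)" using \<sigma> c by simp
  show "AE y in lebesgue. \<forall>R>0. (\<integral>\<^sup>+x\<in>ball y R. ennreal (kern x y) * ennreal (W x) \<partial>lebesgue)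
        \<le> ennreal (c / (1 - \<sigma>) * R powr \<gamma> * W y)"
    using A1_pointwise
  proof eventually_elim
    case (elim y)
    show ?case
    proof (intro allI impI)
      fix R :: real assume R: "0 < R"
      have "(\<integral>\<^sup>+x\<in>ball y R. ennreal (kern x y) * ennreal (W x) \<partial>lebesgue)
        \<le> (\<integral>\<^sup>+x. (\<Sum>j. ennreal ((R / 2 ^ Suc j) powr (\<gamma> - ?d)) * (ennreal (W x) * indicator (ball y (R / 2 ^ j)) x)) \<partial>lebesgue)"
      proof (rule nn_integral_mono)
        fix x
        have "ennreal (kern x y) * ennreal (W x) * indicator (ball y R) x
           = ennreal (kern x y) * indicator (ball y R) x * ennreal (W x)" by (simp add: mult_ac)
        also have "\<dots> \<le> (\<Sum>j. ennreal ((R / 2 ^ Suc j) powr (\<gamma> - ?d)) * indicator (ball y (R / 2 ^ j)) x) * ennreal (W x)"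
          by (intro mult_right_mono kern_ball_le) auto
        also have "\<dots> = (\<Sum>j. ennreal ((R / 2 ^ Suc j) powr (\<gamma> - ?d)) * (ennreal (W x) * indicator (ball y (R / 2 ^ j)) x))"
          by (subst ennreal_suminf_multc[symmetric]) (simp add: mult_ac)
        finally show "ennreal (kern x y) * ennreal (W x) * indicator (ball y R) x \<le> \<dots>" .
      qed
      also have "\<dots> = (\<Sum>j. ennreal ((R / 2 ^ Suc j) powr (\<gamma> - ?d)) * wmeas W (ball y (R / 2 ^ j)))"
        unfolding wmeas_def 
        by (subst nn_integral_suminf, measurable) (subst nn_integral_cmult; measurable)
      also have "\<dots> \<le> (\<Sum>j. ennreal (\<sigma> ^ j) * ennreal (c * R powr \<gamma> * W y))"
      proof (rule suminf_le)
        fix j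
        let ?t = "R / 2 ^ j"
        have "(R / 2 ^ Suc j) powr (\<gamma> - ?d) = (?t / 2) powr (\<gamma> - ?d)" by (simp add: mult.commute)
        also have "\<dots> = ?t powr (\<gamma> - ?d) * 2 powr (?d - \<gamma>)"
          using two R by (simp only: powr_divide) simp
        finally have eq: "(R / 2 ^ Suc j) powr (\<gamma> - ?d) = ?t powr (\<gamma> - ?d) * 2 powr (?d - \<gamma>)" .
        have "?t powr (\<gamma> - ?d) * ?t powr ?d = ?t powr \<gamma>"
          by (simp flip: powr_add)
        also have "\<dots> = R powr \<gamma> * \<sigma> ^ j"
          using R by (simp add: \<sigma>_pow powr_mult[symmetric] power_one_over)
        finally have t: "?t powr (\<gamma> - ?d) * ?t powr ?d = R powr \<gamma> * \<sigma> ^ j" .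
        have "(R / 2 ^ Suc j) powr (\<gamma> - ?d) * v y ?t
            \<le> (R / 2 ^ Suc j) powr (\<gamma> - ?d) * (C * 2 powr ?d * ?t powr ?d * W y)"
          using elim R by (intro mult_left_mono) auto
        also have "\<dots> = c * W y * (?t powr (\<gamma> - ?d) * ?t powr ?d)"
          unfolding eq c_def by (simp only: mult_ac)
        also have "\<dots> = \<sigma> ^ j * (c * R powr \<gamma> * W y)"
          unfolding t by (simp only: mult_ac)
        finally have le: "(R / 2 ^ Suc j) powr (\<gamma> - ?d) * v y ?t \<le> \<sigma> ^ j * (c * R powr \<gamma> * W y)" .
        have "ennreal ((R / 2 ^ Suc j) powr (\<gamma> - ?d)) * wmeas W (ball y (R / 2 ^ j))
            = ennreal ((R / 2 ^ Suc j) powr (\<gamma> - ?d) * v y (R / 2 ^ j))"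
          using R v_pos[of "R / 2 ^ j" y] by (simp add: wmeas_ball ennreal_mult)
        also have "\<dots> \<le> ennreal (\<sigma> ^ j * (c * R powr \<gamma> * W y))" by (rule ennreal_leI[OF le])
        also have "\<dots> = ennreal (\<sigma> ^ j) * ennreal (c * R powr \<gamma> * W y)"
          using \<sigma> c W_nonneg by (intro ennreal_mult) auto
        finally show "ennreal ((R / 2 ^ Suc j) powr (\<gamma> - ?d)) * wmeas W (ball y (R / 2 ^ j))
            \<le> ennreal (\<sigma> ^ j) * ennreal (c * R powr \<gamma> * W y)" .
      qed auto
      also have "\<dots> = (\<Sum>j. ennreal (\<sigma> ^ j)) * ennreal (c * R powr \<gamma> * W y)" by simp
      also have "(\<Sum>j. ennreal (\<sigma> ^ j)) = ennreal (1 / (1 - \<sigma>))"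
        using \<sigma> by (intro suminf_ennreal_eq geometric_sums) auto
      also have "ennreal (1 / (1 - \<sigma>)) * ennreal (c * R powr \<gamma> * W y) = ennreal (c / (1 - \<sigma>) * R powr \<gamma> * W y)"
        using \<sigma> c W_nonneg[of y] by (subst ennreal_mult[symmetric]) auto
      finally show "(\<integral>\<^sup>+x\<in>ball y R. ennreal (kern x y) * ennreal (W x) \<partial>lebesgue)
        \<le> ennreal (c / (1 - \<sigma>) * R powr \<gamma> * W y)" .
    qed
  qed
qed

text \<open>This is the weak type bound for the kernel at a point: split \<open>E\<close> at the radius \<open>R\<close> for
  which the two parts balance.\<close>

lemma kern_set_integral_le:
  obtains K where "0 < K"
    "AE y in lebesgue. \<forall>E\<in>sets lebesgue. \<forall>e>0. wmeas W E = ennreal e \<longrightarrow>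
       (\<integral>\<^sup>+x\<in>E. ennreal (kern x y) * ennreal (W x) \<partial>lebesgue)
        \<le> ennreal (K * W y powr \<kappa> * e powr (1 - \<kappa>))"
proof -
  let ?d = "real CARD('n)"
  have d: "0 < ?d" by simp
  obtain K where K: "0 < K"
    and KAE: "AE y in lebesgue. \<forall>R>0. (\<integral>\<^sup>+x\<in>ball y R. ennreal (kern x y) * ennreal (W x) \<partial>lebesgue)
        \<le> ennreal (K * R powr \<gamma> * W y)"
    by (rule kern_ball_integral_le)
  have "AE y in lebesgue. \<forall>E\<in>sets lebesgue. \<forall>e>0. wmeas W E = ennreal e \<longrightarrow>
       (\<integral>\<^sup>+x\<in>E. ennreal (kern x y) * ennreal (W x) \<partial>lebesgue)
        \<le> ennreal ((K + 1) * W y powr \<kappa> * e powr (1 - \<kappa>))"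
    using KAE W_pos_AE
  proof eventually_elim
    case (elim y)
    show ?case
    proof (intro ballI allI impI)
      fix E :: "(real^'n) set" and e :: real
      assume E [measurable]: "E \<in> sets lebesgue" and e: "0 < e" "wmeas W E = ennreal e"
      \<comment> \<open>\<open>R\<close> solves \<open>R powr n * W y = e\<close>; with this choice
        \<open>eq1\<close> and \<open>eq2\<close> have the same right-hand side.\<close>
      define R where "R = (e / W y) powr (1 / ?d)"
      have R: "0 < R" using e elim by (simp add: R_def)
      have eq1: "R powr \<gamma> * W y = W y powr \<kappa> * e powr (1 - \<kappa>)"
      proof -
        have "R powr \<gamma> * W y = e powr (\<gamma> / ?d) * (W y powr (- (\<gamma> / ?d)) * W y powr 1)"
          using e elim by (simp add: R_def powr_powr powr_divide powr_minus_divide)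
        also have "W y powr (- (\<gamma> / ?d)) * W y powr 1 = W y powr \<kappa>"
          unfolding powr_add[symmetric] by (rule arg_cong[where f="(powr) (W y)"]) (use \<kappa>(3) in linarith)
        finally show ?thesis using \<kappa>(3) by (simp add: mult_ac)
      qed
      have eq2: "R powr (\<gamma> - ?d) * e = W y powr \<kappa> * e powr (1 - \<kappa>)"
      proof -
        have "1 / ?d * (\<gamma> - ?d) = - \<kappa>" by (simp add: \<kappa>_def field_simps)
        then have "R powr (\<gamma> - ?d) * e = W y powr \<kappa> * (e powr (- \<kappa>) * e powr 1)"
          using e elim by (simp add: R_def powr_powr powr_divide powr_minus_divide)
        also have "e powr (- \<kappa>) * e powr 1 = e powr (1 - \<kappa>)" unfolding powr_add[symmetric] by simp
        finally show ?thesis .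
      qed
      have "(\<integral>\<^sup>+x\<in>E. ennreal (kern x y) * ennreal (W x) \<partial>lebesgue)
        \<le> (\<integral>\<^sup>+x. ennreal (kern x y) * ennreal (W x) * indicator (ball y R) x
            + ennreal (R powr (\<gamma> - ?d)) * (ennreal (W x) * indicator E x) \<partial>lebesgue)"
      proof (rule nn_integral_mono)
        fix x
        show "ennreal (kern x y) * ennreal (W x) * indicator E x
           \<le> ennreal (kern x y) * ennreal (W x) * indicator (ball y R) x
            + ennreal (R powr (\<gamma> - ?d)) * (ennreal (W x) * indicator E x)"
        proof (cases "x \<in> ball y R")
          case False
          then have "kern x y \<le> R powr (\<gamma> - ?d)"
            using R by (intro kern_le) (auto simp: dist_norm norm_minus_commute)
          with False show ?thesis
            by (auto simp: indicator_def intro!: mult_right_mono ennreal_leI)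
        qed (auto simp: indicator_def)
      qed
      also have "\<dots> = (\<integral>\<^sup>+x\<in>ball y R. ennreal (kern x y) * ennreal (W x) \<partial>lebesgue)
            + ennreal (R powr (\<gamma> - ?d)) * wmeas W E"
        unfolding wmeas_def by (subst nn_integral_add; (subst nn_integral_cmult)?; simp)
      also have "\<dots> \<le> ennreal (K * R powr \<gamma> * W y) + ennreal (R powr (\<gamma> - ?d)) * wmeas W E"
        using elim R by (intro add_right_mono) auto
      also have "\<dots> = ennreal (K * (R powr \<gamma> * W y) + R powr (\<gamma> - ?d) * e)"
        using e elim K by (simp add: ennreal_plus ennreal_mult[symmetric] mult.assoc flip: ennreal_plus)
      also have "\<dots> = ennreal ((K + 1) * W y powr \<kappa> * e powr (1 - \<kappa>))"
        unfolding eq1 eq2 by (simp add: algebra_simps)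
      finally show "(\<integral>\<^sup>+x\<in>E. ennreal (kern x y) * ennreal (W x) \<partial>lebesgue)
        \<le> ennreal ((K + 1) * W y powr \<kappa> * e powr (1 - \<kappa>))" .
    qed
  qed
  with K that[of "K + 1"] show ?thesis by simp
qed

text \<open>The \<open>\<kappa>\<close>-th power of \<open>A1\<close> bounds 1 on the ball by a
  multiple of \<open>W powr \<kappa>\<close>; the exponent of \<open>r\<close> is
  \<open>n * \<kappa> = n - \<gamma>\<close>. This converts unweighted integrals of the far part
  into weighted ones.\<close>

lemma ball_integral_le:
  assumes [measurable]: "h \<in> borel_measurable lebesgue" and r: "0 < r"
  shows "(\<integral>\<^sup>+x\<in>ball y r. h x \<partial>lebesgue)
    \<le> ennreal (C powr \<kappa> * r powr (real CARD('n) - \<gamma>) / v y r powr \<kappa>)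
        * (\<integral>\<^sup>+x\<in>ball y r. h x * ennreal (W x powr \<kappa>) \<partial>lebesgue)"
    (is "_ \<le> ennreal ?c * _")
proof -
  have c: "0 \<le> ?c" by simp
  have "(\<integral>\<^sup>+x\<in>ball y r. h x \<partial>lebesgue)
     \<le> (\<integral>\<^sup>+x. ennreal ?c * (h x * ennreal (W x powr \<kappa>) * indicator (ball y r) x) \<partial>lebesgue)"
  proof (rule nn_integral_mono_AE)
    show "AE x in lebesgue. h x * indicator (ball y r) x
        \<le> ennreal ?c * (h x * ennreal (W x powr \<kappa>) * indicator (ball y r) x)"
      using v_le_AE[OF r, of y]
    proof eventually_elim
      case (elim x)
      show ?case
      proof (cases "x \<in> ball y r")
        case True
        with elim have "v y r powr \<kappa> \<le> (C * r powr real CARD('n) * W x) powr \<kappa>"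
          using v_pos[OF r, of y] \<kappa> by (intro powr_mono2) auto
        also have "\<dots> = C powr \<kappa> * r powr (real CARD('n) - \<gamma>) * W x powr \<kappa>"
          using C_pos W_nonneg r \<kappa>(4) by (simp add: powr_mult powr_powr)
        finally have "1 \<le> ?c * W x powr \<kappa>"
          using v_pos[OF r, of y] by (simp add: field_simps)
        then have "ennreal 1 \<le> ennreal (?c * W x powr \<kappa>)" by (rule ennreal_leI)
        then have "h x * 1 \<le> h x * (ennreal ?c * ennreal (W x powr \<kappa>))"
          by (intro mult_left_mono) (simp_all add: ennreal_mult[symmetric])
        with True show ?thesis by (simp add: mult_ac)
      qed auto
    qed
  qed
  also have "\<dots> = ennreal ?c * (\<integral>\<^sup>+x\<in>ball y r. h x * ennreal (W x powr \<kappa>) \<partial>lebesgue)"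
    by (rule nn_integral_cmult) measurable
  finally show ?thesis .
qed

section \<open>Potentials integrated over subsets of a ball\<close>

definition potential :: "(real^'n \<Rightarrow> ennreal) \<Rightarrow> real^'n \<Rightarrow> ennreal" where
  "potential h x = (\<integral>\<^sup>+z. h z * ennreal (kern x z) \<partial>lebesgue)"

text \<open>In the application \<open>W powr \<kappa>\<close> is the original weight
  \<open>w\<close>, so for \<open>h = |f|\<close> this is the inner norm of \<open>f\<close> over
  the ball.\<close>

definition ball_mass :: "(real^'n \<Rightarrow> ennreal) \<Rightarrow> real^'n \<Rightarrow> real \<Rightarrow> ennreal" where
  "ball_mass h y r = (\<integral>\<^sup>+x\<in>ball y r. h x * ennreal (W x powr \<kappa>) \<partial>lebesgue)"

lemma potential_measurable [measurable]:
  assumes [measurable]: "h \<in> borel_measurable lebesgue"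
  shows "potential h \<in> borel_measurable lebesgue"
proof -
  have "(\<lambda>p. h (snd p) * ennreal (kern (fst p) (snd p))) \<in> borel_measurable (lebesgue \<Otimes>\<^sub>M lebesgue)"
    by measurable
  then show ?thesis
    unfolding potential_def
    by (intro lebesgue.borel_measurable_nn_integral) (simp add: case_prod_unfold)
qed

lemma potential_set_integral_swap:
  assumes [measurable]: "h \<in> borel_measurable lebesgue" "E \<in> sets lebesgue"
  shows "(\<integral>\<^sup>+x\<in>E. potential h x * ennreal (W x) \<partial>lebesgue)
    = (\<integral>\<^sup>+z. h z * (\<integral>\<^sup>+x\<in>E. ennreal (kern x z) * ennreal (W x) \<partial>lebesgue) \<partial>lebesgue)"
proof -
  let ?F = "\<lambda>p. h (snd p) * (ennreal (kern (fst p) (snd p)) * ennreal (W (fst p)) * indicator E (fst p))"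
  have F: "?F \<in> borel_measurable (lebesgue \<Otimes>\<^sub>M lebesgue)" by measurable
  have "(\<integral>\<^sup>+x\<in>E. potential h x * ennreal (W x) \<partial>lebesgue)
      = (\<integral>\<^sup>+x. \<integral>\<^sup>+z. ?F (x, z) \<partial>lebesgue \<partial>lebesgue)"
  proof (rule nn_integral_cong)
    fix x
    have "potential h x * ennreal (W x) * indicator E x
        = (\<integral>\<^sup>+z. (h z * ennreal (kern x z)) * (ennreal (W x) * indicator E x) \<partial>lebesgue)"
      unfolding potential_def by (subst nn_integral_multc; measurable?) (simp add: mult.assoc)
    then show "potential h x * ennreal (W x) * indicator E x = (\<integral>\<^sup>+z. ?F (x, z) \<partial>lebesgue)"
      by (simp add: mult.assoc)
  qed
  also have "\<dots> = (\<integral>\<^sup>+z. \<integral>\<^sup>+x. ?F (x, z) \<partial>lebesgue \<partial>lebesgue)"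
    by (intro lebesgue_pair.Fubini'[symmetric]) (use F in \<open>simp add: case_prod_unfold\<close>)
  also have "\<dots> = (\<integral>\<^sup>+z. h z * (\<integral>\<^sup>+x\<in>E. ennreal (kern x z) * ennreal (W x) \<partial>lebesgue) \<partial>lebesgue)"
    by (intro nn_integral_cong) (subst nn_integral_cmult[symmetric]; measurable?; simp)
  finally show ?thesis .
qed

text \<open>If \<open>z\<close> is at distance at least \<open>2 ^ k * (2 * r)\<close> from
  \<open>y\<close>, it is at least \<open>2 ^ k * r\<close> away from \<open>E\<close>. The index
  \<open>k\<close> depends on \<open>z\<close>; the sum with indicators removes this dependence
  before integration in \<open>z\<close>.\<close>

lemma kern_set_integral_far_le:
  assumes E [measurable]: "E \<in> sets lebesgue" and "E \<subseteq> ball y r" and "0 < r"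
    and z: "z \<notin> ball y (2 * r)" and e: "wmeas W E = ennreal e" "0 < e"
  shows "(\<integral>\<^sup>+x\<in>E. ennreal (kern x z) * ennreal (W x) \<partial>lebesgue)
    \<le> (\<Sum>k. ennreal ((2 ^ k * r) powr (\<gamma> - real CARD('n)) * e)
          * indicator (ball y (2 ^ Suc (Suc k) * r)) z)"
proof -
  let ?d = "real CARD('n)"
  obtain k where k: "2 ^ k * (2 * r) \<le> dist y z" "dist y z < 2 ^ Suc k * (2 * r)"
    using obtain_dyadic_shell_outside[of "2 * r" "dist y z"] z \<open>0 < r\<close> by auto
  have "kern x z \<le> (2 ^ k * r) powr (\<gamma> - ?d)" if "x \<in> E" for x
  proof (rule kern_le)
    have "dist y x < r" using that assms(2) by auto
    moreover have "r \<le> 2 ^ k * r" using \<open>0 < r\<close> by simp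
    ultimately show "2 ^ k * r \<le> norm (x - z)"
      using k dist_triangle[of y z x] by (simp add: dist_norm)
  qed (use \<open>0 < r\<close> in simp)
  then have "(\<integral>\<^sup>+x\<in>E. ennreal (kern x z) * ennreal (W x) \<partial>lebesgue)
      \<le> (\<integral>\<^sup>+x. ennreal ((2 ^ k * r) powr (\<gamma> - ?d)) * (ennreal (W x) * indicator E x) \<partial>lebesgue)"
    by (intro nn_integral_mono) (auto simp: indicator_def intro!: mult_right_mono ennreal_leI)
  also have "\<dots> = ennreal ((2 ^ k * r) powr (\<gamma> - ?d)) * wmeas W E"
    unfolding wmeas_def by (rule nn_integral_cmult) measurable
  also have "\<dots> = ennreal ((2 ^ k * r) powr (\<gamma> - ?d) * e) * indicator (ball y (2 ^ Suc (Suc k) * r)) z"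
    using k e by (simp add: ennreal_mult mult_ac)
  also have "\<dots> \<le> (\<Sum>k. ennreal ((2 ^ k * r) powr (\<gamma> - ?d) * e)
          * indicator (ball y (2 ^ Suc (Suc k) * r)) z)"
    by (rule sum_le_suminf[of _ "{k}", simplified]) auto
  finally show ?thesis .
qed

text \<open>The kernel factor cancels the power of the radius in \<open>ball_integral_le\<close> up
  to \<open>4 powr (n - \<gamma>)\<close>, as the ball has radius \<open>4 * (2 ^ k * r)\<close>.
  Splitting \<open>e\<close> as \<open>e powr (1 - \<kappa>) * e powr \<kappa>\<close> and using
  \<open>e \<le> v y r\<close> in the second factor yields the mass ratio.\<close>

lemma far_ball_integral_le:
  assumes [measurable]: "h \<in> borel_measurable lebesgue" and "0 < r" and e: "0 < e" "e \<le> v y r"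
  shows "ennreal ((2 ^ k * r) powr (\<gamma> - real CARD('n)) * e)
        * (\<integral>\<^sup>+z\<in>ball y (2 ^ Suc (Suc k) * r). h z \<partial>lebesgue)
    \<le> ennreal (C powr \<kappa> * 4 powr (real CARD('n) - \<gamma>) * e powr (1 - \<kappa>)
          * (v y r / v y (2 ^ Suc (Suc k) * r)) powr \<kappa>)
        * ball_mass h y (2 ^ Suc (Suc k) * r)"
proof -
  let ?d = "real CARD('n)" and ?R = "2 ^ Suc (Suc k) * r"
  have R: "0 < ?R" using \<open>0 < r\<close> by simp
  have vR: "0 < v y ?R" by (rule v_pos[OF R])
  have vr: "0 < v y r" by (rule v_pos[OF \<open>0 < r\<close>])
  have "?R powr (?d - \<gamma>) = (4 * (2 ^ k * r)) powr (?d - \<gamma>)" by (simp add: mult_ac)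
  also have "\<dots> = 4 powr (?d - \<gamma>) * (2 ^ k * r) powr (?d - \<gamma>)"
    using \<open>0 < r\<close> by (subst powr_mult) auto
  finally have R2: "?R powr (?d - \<gamma>) = 4 powr (?d - \<gamma>) * (2 ^ k * r) powr (?d - \<gamma>)" .
  have one: "(2 ^ k * r) powr (\<gamma> - ?d) * (2 ^ k * r) powr (?d - \<gamma>) = 1"
    using \<open>0 < r\<close> by (simp flip: powr_add)
  have "e = e powr (1 - \<kappa>) * e powr \<kappa>"
    using e by (simp flip: powr_add)
  also have "\<dots> \<le> e powr (1 - \<kappa>) * v y r powr \<kappa>"
    using e \<kappa> by (intro mult_left_mono powr_mono2) auto
  finally have e_le: "e \<le> e powr (1 - \<kappa>) * v y r powr \<kappa>" .
  have "(2 ^ k * r) powr (\<gamma> - ?d) * e * (C powr \<kappa> * ?R powr (?d - \<gamma>) / v y ?R powr \<kappa>)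
      = ((2 ^ k * r) powr (\<gamma> - ?d) * (2 ^ k * r) powr (?d - \<gamma>))
          * (C powr \<kappa> * 4 powr (?d - \<gamma>) / v y ?R powr \<kappa> * e)"
    unfolding R2 by (simp only: mult_ac times_divide_eq_right times_divide_eq_left)
  also have "\<dots> \<le> C powr \<kappa> * 4 powr (?d - \<gamma>) / v y ?R powr \<kappa> * (e powr (1 - \<kappa>) * v y r powr \<kappa>)"
    unfolding one mult_1_left by (intro mult_left_mono e_le) simp
  also have "\<dots> = C powr \<kappa> * 4 powr (?d - \<gamma>) * e powr (1 - \<kappa>) * (v y r / v y ?R) powr \<kappa>"
    using vR vr by (simp add: powr_divide)
  finally have le: "(2 ^ k * r) powr (\<gamma> - ?d) * e * (C powr \<kappa> * ?R powr (?d - \<gamma>) / v y ?R powr \<kappa>)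
      \<le> C powr \<kappa> * 4 powr (?d - \<gamma>) * e powr (1 - \<kappa>) * (v y r / v y ?R) powr \<kappa>" .
  have "ennreal ((2 ^ k * r) powr (\<gamma> - ?d) * e) * (\<integral>\<^sup>+z\<in>ball y ?R. h z \<partial>lebesgue)
     \<le> ennreal ((2 ^ k * r) powr (\<gamma> - ?d) * e)
        * (ennreal (C powr \<kappa> * ?R powr (?d - \<gamma>) / v y ?R powr \<kappa>) * ball_mass h y ?R)"
    unfolding ball_mass_def by (intro mult_left_mono ball_integral_le R) auto
  also have "\<dots> = ennreal ((2 ^ k * r) powr (\<gamma> - ?d) * e * (C powr \<kappa> * ?R powr (?d - \<gamma>) / v y ?R powr \<kappa>))
        * ball_mass h y ?R"
    unfolding mult.assoc[symmetric] using e by (subst ennreal_mult) auto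
  also have "\<dots> \<le> ennreal (C powr \<kappa> * 4 powr (?d - \<gamma>) * e powr (1 - \<kappa>) * (v y r / v y ?R) powr \<kappa>)
        * ball_mass h y ?R"
    by (intro mult_right_mono ennreal_leI le) simp
  finally show ?thesis .
qed

text \<open>\<open>kern_set_integral_le\<close> handles \<open>z\<close> in the doubled ball,
  \<open>far_ball_integral_le\<close> the shells outside. Both give the factor
  \<open>e powr (1 - \<kappa>)\<close>, which cancels in \<open>level_set_le\<close>.\<close>

lemma potential_set_integral_le:
  obtains K where "0 < K"
    "\<And>h y r E e. h \<in> borel_measurable lebesgue \<Longrightarrow> 0 < r \<Longrightarrow> E \<in> sets lebesgue \<Longrightarrow> E \<subseteq> ball y r
      \<Longrightarrow> 0 < e \<Longrightarrow> wmeas W E = ennreal e \<Longrightarrow>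
      (\<integral>\<^sup>+x\<in>E. potential h x * ennreal (W x) \<partial>lebesgue)
        \<le> (\<Sum>k. ennreal (K * e powr (1 - \<kappa>) * (v y r / v y (2 ^ Suc k * r)) powr \<kappa>)
              * ball_mass h y (2 ^ Suc k * r))"
proof -
  let ?d = "real CARD('n)"
  obtain K1 where K1: "0 < K1"
    and near: "AE z in lebesgue. \<forall>E\<in>sets lebesgue. \<forall>e>0. wmeas W E = ennreal e \<longrightarrow>
       (\<integral>\<^sup>+x\<in>E. ennreal (kern x z) * ennreal (W x) \<partial>lebesgue)
        \<le> ennreal (K1 * W z powr \<kappa> * e powr (1 - \<kappa>))"
    by (rule kern_set_integral_le)
  \<comment> \<open>\<open>Q\<close> is the doubling constant. The near part comes without a mass
    ratio; doubling inserts the ratio for radius \<open>2 * r\<close> at the cost of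
    \<open>Q powr \<kappa>\<close>, making it the initial term of the series.\<close>
  define Q where "Q = C * 2 powr ?d / unit_ball_vol ?d"
  have Q: "0 < Q" using C_pos by (simp add: Q_def unit_ball_vol_pos)
  define K2 where "K2 = C powr \<kappa> * 4 powr (?d - \<gamma>)"
  have K2: "0 < K2" using C_pos by (simp add: K2_def)
  define K where "K = K1 * Q powr \<kappa> + K2"
  have K: "0 < K" using K1 K2 Q by (simp add: K_def add_nonneg_pos)
  show ?thesis
  proof (rule that[OF K])
    fix h :: "real^'n \<Rightarrow> ennreal" and y and r :: real and E and e :: real
    assume h [measurable]: "h \<in> borel_measurable lebesgue" and r: "0 < r"
      and E [measurable]: "E \<in> sets lebesgue" and sub: "E \<subseteq> ball y r"
      and e: "0 < e" "wmeas W E = ennreal e"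
    have ev: "e \<le> v y r"
      using wmeas_mono[OF sub] e v_pos[OF r, of y] by (simp add: wmeas_ball r)
    let ?H = "\<lambda>z. \<integral>\<^sup>+x\<in>E. ennreal (kern x z) * ennreal (W x) \<partial>lebesgue"
    \<comment> \<open>Index 0 is the doubled ball of the near part; the far shell \<open>k\<close>
      therefore uses index \<open>Suc k\<close>.\<close>
    let ?B = "\<lambda>k. ball y (2 ^ Suc k * r)"
    let ?a = "\<lambda>k. (2 ^ k * r) powr (\<gamma> - ?d) * e"
    let ?m = "\<lambda>k. ball_mass h y (2 ^ Suc k * r)"
    let ?c = "\<lambda>k. (v y r / v y (2 ^ Suc k * r)) powr \<kappa>"
    have "(\<integral>\<^sup>+x\<in>E. potential h x * ennreal (W x) \<partial>lebesgue) = (\<integral>\<^sup>+z. h z * ?H z \<partial>lebesgue)"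
      by (rule potential_set_integral_swap) measurable
    also have "\<dots> \<le> (\<integral>\<^sup>+z. ennreal (K1 * e powr (1 - \<kappa>)) * (h z * ennreal (W z powr \<kappa>) * indicator (?B 0) z)
        + (\<Sum>k. ennreal (?a k) * (h z * indicator (?B (Suc k)) z)) \<partial>lebesgue)"
    proof (rule nn_integral_mono_AE)
      show "AE z in lebesgue. h z * ?H z
        \<le> ennreal (K1 * e powr (1 - \<kappa>)) * (h z * ennreal (W z powr \<kappa>) * indicator (?B 0) z)
        + (\<Sum>k. ennreal (?a k) * (h z * indicator (?B (Suc k)) z))"
        using near
      proof eventually_elim
        case (elim z)
        show ?case
        proof (cases "z \<in> ball y (2 * r)")
          case True
          have "?H z \<le> ennreal (K1 * W z powr \<kappa> * e powr (1 - \<kappa>))" using elim E e by blast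
          also have "\<dots> = ennreal (K1 * e powr (1 - \<kappa>)) * ennreal (W z powr \<kappa>)"
            using K1 by (subst ennreal_mult[symmetric]) (auto simp: mult_ac)
          finally have "h z * ?H z \<le> h z * (ennreal (K1 * e powr (1 - \<kappa>)) * ennreal (W z powr \<kappa>))"
            by (intro mult_left_mono) auto
          also have "\<dots> = ennreal (K1 * e powr (1 - \<kappa>)) * (h z * ennreal (W z powr \<kappa>) * indicator (?B 0) z)"
            using True by (simp add: mult_ac)
          finally show ?thesis by (rule order_trans) simp
        next
          case False
          have "h z * ?H z \<le> h z * (\<Sum>k. ennreal (?a k) * indicator (?B (Suc k)) z)"
            by (intro mult_left_mono kern_set_integral_far_le[OF E sub r False e(2) e(1)]) simp
          also have "\<dots> = (\<Sum>k. ennreal (?a k) * (h z * indicator (?B (Suc k)) z))"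
            by (subst ennreal_suminf_cmult[symmetric]) (simp only: mult_ac)
          finally show ?thesis by (rule order_trans) simp
        qed
      qed
    qed
    also have "\<dots> = ennreal (K1 * e powr (1 - \<kappa>)) * ?m 0
        + (\<Sum>k. ennreal (?a k) * (\<integral>\<^sup>+z\<in>?B (Suc k). h z \<partial>lebesgue))"
    proof (subst nn_integral_add)
      have "(\<integral>\<^sup>+z. ennreal (K1 * e powr (1 - \<kappa>)) * (h z * ennreal (W z powr \<kappa>) * indicator (?B 0) z) \<partial>lebesgue)
          = ennreal (K1 * e powr (1 - \<kappa>)) * ?m 0"
        unfolding ball_mass_def by (rule nn_integral_cmult) measurable
      moreover have "(\<integral>\<^sup>+z. (\<Sum>k. ennreal (?a k) * (h z * indicator (?B (Suc k)) z)) \<partial>lebesgue)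
          = (\<Sum>k. \<integral>\<^sup>+z. ennreal (?a k) * (h z * indicator (?B (Suc k)) z) \<partial>lebesgue)"
        by (rule nn_integral_suminf) measurable
      moreover have "(\<integral>\<^sup>+z. ennreal (?a k) * (h z * indicator (?B (Suc k)) z) \<partial>lebesgue)
          = ennreal (?a k) * (\<integral>\<^sup>+z\<in>?B (Suc k). h z \<partial>lebesgue)" for k
        by (rule nn_integral_cmult) measurable
      ultimately show "(\<integral>\<^sup>+z. ennreal (K1 * e powr (1 - \<kappa>)) * (h z * ennreal (W z powr \<kappa>) * indicator (?B 0) z) \<partial>lebesgue)
         + (\<integral>\<^sup>+z. (\<Sum>k. ennreal (?a k) * (h z * indicator (?B (Suc k)) z)) \<partial>lebesgue)
         = ennreal (K1 * e powr (1 - \<kappa>)) * ?m 0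
        + (\<Sum>k. ennreal (?a k) * (\<integral>\<^sup>+z\<in>?B (Suc k). h z \<partial>lebesgue))"
        by presburger
    qed measurable
    also have "\<dots> \<le> ennreal (K * e powr (1 - \<kappa>) * ?c 0) * ?m 0
        + (\<Sum>k. ennreal (K * e powr (1 - \<kappa>) * ?c (Suc k)) * ?m (Suc k))"
    proof (intro add_mono suminf_le mult_right_mono ennreal_leI)
      have "1 \<le> Q * (v y r / v y (2 ^ Suc 0 * r))"
        using v_doubling[OF r, of y] v_pos[of "2 * r" y] r by (simp add: Q_def field_simps)
      then have "1 powr \<kappa> \<le> (Q * (v y r / v y (2 ^ Suc 0 * r))) powr \<kappa>"
        using \<kappa> by (intro powr_mono2) auto
      also have "\<dots> = Q powr \<kappa> * ?c 0"
        using Q v_pos[OF r, of y] v_pos[of "2 ^ Suc 0 * r" y] r by (subst powr_mult) auto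
      finally have "K1 * 1 \<le> K1 * (Q powr \<kappa> * ?c 0)"
        using K1 by (intro mult_left_mono) auto
      also have "\<dots> \<le> K * ?c 0"
        unfolding K_def using K2 by (simp add: algebra_simps)
      finally have "K1 * e powr (1 - \<kappa>) \<le> (K * ?c 0) * e powr (1 - \<kappa>)"
        by (intro mult_right_mono) auto
      then show "K1 * e powr (1 - \<kappa>) \<le> K * e powr (1 - \<kappa>) * ?c 0" by (simp only: mult_ac)
      fix k
      have "ennreal (?a k) * (\<integral>\<^sup>+z\<in>?B (Suc k). h z \<partial>lebesgue)
         \<le> ennreal (K2 * e powr (1 - \<kappa>) * ?c (Suc k)) * ?m (Suc k)"
        using far_ball_integral_le[OF h r e(1) ev, of k] by (simp only: K2_def)
      also have "\<dots> \<le> ennreal (K * e powr (1 - \<kappa>) * ?c (Suc k)) * ?m (Suc k)"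
        using K1 Q by (intro mult_right_mono ennreal_leI) (auto simp: K_def)
      finally show "ennreal (?a k) * (\<integral>\<^sup>+z\<in>?B (Suc k). h z \<partial>lebesgue)
         \<le> ennreal (K * e powr (1 - \<kappa>) * ?c (Suc k)) * ?m (Suc k)" .
    qed auto
    also have "\<dots> = (\<Sum>k. ennreal (K * e powr (1 - \<kappa>) * ?c k) * ?m k)"
      by (rule suminf_ennreal_split_first[symmetric])
    finally show "(\<integral>\<^sup>+x\<in>E. potential h x * ennreal (W x) \<partial>lebesgue)
        \<le> (\<Sum>k. ennreal (K * e powr (1 - \<kappa>) * ?c k) * ?m k)" .
  qed
qed

text \<open>By Chebyshev \<open>t * W(E)\<close> is at most the integral of the potential over
  \<open>E\<close>. Division by \<open>W(E) powr (1 - \<kappa>)\<close> leaves the left side here.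
  The exponent \<open>\<epsilon>\<close> may be negative: the product of
  \<open>W(B) powr \<epsilon>\<close> and the mass ratio to the power \<open>\<kappa>\<close> is the
  ratio to the power \<open>\<eta>\<close> times \<open>W(B_k) powr \<epsilon>\<close>, and
  \<open>\<eta> > 0\<close> suffices for geometric decay.\<close>

lemma level_set_le:
  assumes "0 < \<eta>" and "\<epsilon> + \<kappa> = \<eta>"
  obtains K \<theta> where "0 < K" "0 < \<theta>" "\<theta> < 1"
    "\<And>h y r E t. h \<in> borel_measurable lebesgue \<Longrightarrow> 0 < r \<Longrightarrow> E \<in> sets lebesgue \<Longrightarrow> E \<subseteq> ball y r
      \<Longrightarrow> 0 < t \<Longrightarrow> (\<And>x. x \<in> E \<Longrightarrow> ennreal t \<le> potential h x) \<Longrightarrow>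
      wmeas W (ball y r) epowr \<epsilon> * (ennreal t * wmeas W E epowr \<kappa>)
        \<le> ennreal K * (\<Sum>k. ennreal (\<theta> ^ k) *
            (wmeas W (ball y (2 ^ Suc k * r)) epowr \<epsilon> * ball_mass h y (2 ^ Suc k * r)))"
proof -
  obtain K where K: "0 < K" and main:
    "\<And>h y r E e. h \<in> borel_measurable lebesgue \<Longrightarrow> 0 < r \<Longrightarrow> E \<in> sets lebesgue \<Longrightarrow> E \<subseteq> ball y r
      \<Longrightarrow> 0 < e \<Longrightarrow> wmeas W E = ennreal e \<Longrightarrow>
      (\<integral>\<^sup>+x\<in>E. potential h x * ennreal (W x) \<partial>lebesgue)
        \<le> (\<Sum>k. ennreal (K * e powr (1 - \<kappa>) * (v y r / v y (2 ^ Suc k * r)) powr \<kappa>)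
              * ball_mass h y (2 ^ Suc k * r))"
    by (rule potential_set_integral_le) blast
  obtain \<theta>0 where \<theta>0: "0 < \<theta>0" "\<theta>0 < 1" and rev: "\<And>y r k. 0 < r \<Longrightarrow> v y r \<le> \<theta>0 ^ k * v y (2 ^ k * r)"
    by (rule v_reverse_doubling) blast
  define \<theta> where "\<theta> = \<theta>0 powr \<eta>"
  have \<theta>: "0 < \<theta>" "\<theta> < 1"
    using \<theta>0 \<open>0 < \<eta>\<close> powr_less_mono2[of \<eta> \<theta>0 1] by (auto simp: \<theta>_def)
  have \<theta>_pow: "(\<theta>0 ^ k) powr \<eta> = \<theta> ^ k" for k
    using \<theta>0 by (induction k) (simp_all add: \<theta>_def powr_mult)
  show ?thesis
  proof (rule that[OF K \<theta>])
    fix h :: "real^'n \<Rightarrow> ennreal" and y and r :: real and E and t :: real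
    assume h [measurable]: "h \<in> borel_measurable lebesgue" and r: "0 < r"
      and E [measurable]: "E \<in> sets lebesgue" and sub: "E \<subseteq> ball y r"
      and t: "0 < t" and le: "\<And>x. x \<in> E \<Longrightarrow> ennreal t \<le> potential h x"
    let ?m = "\<lambda>k. ball_mass h y (2 ^ Suc k * r)"
    let ?v = "\<lambda>k. v y (2 ^ Suc k * r)"
    have v: "0 < v y r" "\<And>k. 0 < ?v k" using r by (auto intro: v_pos)
    have "wmeas W E \<le> wmeas W (ball y r)" by (rule wmeas_mono[OF sub])
    also have "\<dots> < \<infinity>" by (rule finite_ball[OF r])
    finally obtain e where e: "wmeas W E = ennreal e" "0 \<le> e"
      by (cases "wmeas W E") auto
    show "wmeas W (ball y r) epowr \<epsilon> * (ennreal t * wmeas W E epowr \<kappa>)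
        \<le> ennreal K * (\<Sum>k. ennreal (\<theta> ^ k) *
            (wmeas W (ball y (2 ^ Suc k * r)) epowr \<epsilon> * ?m k))"
    proof (cases "e = 0")
      \<comment> \<open>A null set makes the left side 0, since \<open>0 epowr \<kappa> = 0\<close>;
        otherwise \<open>e\<close> can be divided by.\<close>
      case True
      then show ?thesis using e \<kappa> by (simp add: epowr_def)
    next
      case False
      with e have e0: "0 < e" by simp
      have "ennreal (t * e) = (\<integral>\<^sup>+x. ennreal t * (ennreal (W x) * indicator E x) \<partial>lebesgue)"
        using e t unfolding wmeas_def by (subst nn_integral_cmult) (auto simp: ennreal_mult)
      also have "\<dots> \<le> (\<integral>\<^sup>+x\<in>E. potential h x * ennreal (W x) \<partial>lebesgue)"
        by (intro nn_integral_mono) (auto simp: indicator_def intro!: mult_right_mono le)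
      also have "\<dots> \<le> (\<Sum>k. ennreal (K * e powr (1 - \<kappa>) * (v y r / ?v k) powr \<kappa>) * ?m k)"
        by (rule main[OF h r E sub e0 e(1)])
      finally have 1: "ennreal (t * e) \<le> (\<Sum>k. ennreal (K * e powr (1 - \<kappa>) * (v y r / ?v k) powr \<kappa>) * ?m k)" .
      have te: "t * e powr \<kappa> = e powr (\<kappa> - 1) * (t * e)"
      proof -
        have "e powr (\<kappa> - 1) * e = e powr \<kappa>" using e0 by (simp add: powr_diff)
        then show ?thesis by (simp add: mult_ac)
      qed
      have "wmeas W (ball y r) epowr \<epsilon> * (ennreal t * wmeas W E epowr \<kappa>)
          = ennreal (v y r powr \<epsilon> * (t * e powr \<kappa>))"
        using v e0 e t r by (simp add: wmeas_ball epowr_ennreal ennreal_mult)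
      also have "\<dots> = ennreal (v y r powr \<epsilon> * e powr (\<kappa> - 1)) * ennreal (t * e)"
        unfolding te using t e0 by (subst ennreal_mult[symmetric]) (auto simp: mult_ac)
      also have "\<dots> \<le> ennreal (v y r powr \<epsilon> * e powr (\<kappa> - 1))
          * (\<Sum>k. ennreal (K * e powr (1 - \<kappa>) * (v y r / ?v k) powr \<kappa>) * ?m k)"
        by (intro mult_left_mono 1) simp
      also have "\<dots> = (\<Sum>k. ennreal (v y r powr \<epsilon> * e powr (\<kappa> - 1))
          * (ennreal (K * e powr (1 - \<kappa>) * (v y r / ?v k) powr \<kappa>) * ?m k))"
        by (rule ennreal_suminf_cmult[symmetric])
      also have "\<dots> \<le> (\<Sum>k. ennreal K * (ennreal (\<theta> ^ k) * (ennreal (?v k powr \<epsilon>) * ?m k)))"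
      proof (rule suminf_le)
        fix k
        have e1: "e powr (\<kappa> - 1) * e powr (1 - \<kappa>) = 1"
          using e0 by (simp flip: powr_add)
        have "v y r powr \<epsilon> * (v y r / ?v k) powr \<kappa> = (v y r / ?v k) powr \<eta> * ?v k powr \<epsilon>"
          using v(1) v(2)[of k] assms(2)[symmetric] by (simp add: powr_divide powr_add)
        also have "\<dots> \<le> \<theta> ^ Suc k * ?v k powr \<epsilon>"
          unfolding \<theta>_pow[symmetric] using rev[OF r, of y "Suc k"] v(1) v(2)[of k] \<open>0 < \<eta>\<close>
          by (intro mult_right_mono powr_mono2) (auto simp: field_simps)
        \<comment> \<open>The radius \<open>2 ^ Suc k * r\<close> yields
          \<open>\<theta> ^ Suc k\<close>; one factor below 1 is dropped.\<close>
        also have "\<dots> \<le> \<theta> ^ k * ?v k powr \<epsilon>"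
          using \<theta> by (intro mult_right_mono power_decreasing) auto
        finally have 2: "v y r powr \<epsilon> * (v y r / ?v k) powr \<kappa> \<le> \<theta> ^ k * ?v k powr \<epsilon>" .
        have "v y r powr \<epsilon> * e powr (\<kappa> - 1) * (K * e powr (1 - \<kappa>) * (v y r / ?v k) powr \<kappa>)
            = (e powr (\<kappa> - 1) * e powr (1 - \<kappa>)) * (K * (v y r powr \<epsilon> * (v y r / ?v k) powr \<kappa>))"
          by (simp only: mult_ac)
        also have "\<dots> \<le> K * (\<theta> ^ k * ?v k powr \<epsilon>)"
          unfolding e1 mult_1_left using K by (intro mult_left_mono 2) simp
        finally have 3: "v y r powr \<epsilon> * e powr (\<kappa> - 1) * (K * e powr (1 - \<kappa>) * (v y r / ?v k) powr \<kappa>)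
            \<le> K * (\<theta> ^ k * ?v k powr \<epsilon>)" .
        have "ennreal (v y r powr \<epsilon> * e powr (\<kappa> - 1)) * (ennreal (K * e powr (1 - \<kappa>) * (v y r / ?v k) powr \<kappa>) * ?m k)
            = ennreal (v y r powr \<epsilon> * e powr (\<kappa> - 1) * (K * e powr (1 - \<kappa>) * (v y r / ?v k) powr \<kappa>)) * ?m k"
          using K by (subst mult.assoc[symmetric], subst ennreal_mult[symmetric]) auto
        also have "\<dots> \<le> ennreal (K * (\<theta> ^ k * ?v k powr \<epsilon>)) * ?m k"
          by (intro mult_right_mono ennreal_leI 3) simp
        also have "\<dots> = ennreal K * (ennreal (\<theta> ^ k) * (ennreal (?v k powr \<epsilon>) * ?m k))"
          using K \<theta> by (simp add: ennreal_mult mult.assoc)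
        finally show "ennreal (v y r powr \<epsilon> * e powr (\<kappa> - 1)) * (ennreal (K * e powr (1 - \<kappa>) * (v y r / ?v k) powr \<kappa>) * ?m k)
            \<le> ennreal K * (ennreal (\<theta> ^ k) * (ennreal (?v k powr \<epsilon>) * ?m k))" .
      qed auto
      also have "\<dots> = ennreal K * (\<Sum>k. ennreal (\<theta> ^ k) * (wmeas W (ball y (2 ^ Suc k * r)) epowr \<epsilon> * ?m k))"
        using v r by (simp add: wmeas_ball epowr_ennreal)
      finally show ?thesis .
    qed
  qed
qed

end

section \<open>The fractional integral operator and the theorem\<close>

lemma locally_integrable_imp_measurable:
  fixes f :: "real^'n \<Rightarrow> 'b::euclidean_space"
  assumes "locally_integrable f"
  shows "f \<in> borel_measurable lebesgue"
proof (rule borel_measurable_LIMSEQ_metric)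
  fix m :: nat
  have "f absolutely_integrable_on cball 0 (real m)"
    using assms by (simp add: locally_integrable_def)
  then show "(\<lambda>x. indicat_real (cball 0 (real m)) x *\<^sub>R f x) \<in> borel_measurable lebesgue"
    unfolding set_integrable_def by (rule borel_measurable_integrable)
next
  fix x :: "real^'n"
  obtain N where N: "norm x < real N" using reals_Archimedean2 by blast
  have "\<forall>m\<ge>N. indicat_real (cball 0 (real m)) x *\<^sub>R f x = f x"
    using N by (auto simp: indicator_def)
  then show "(\<lambda>m. indicat_real (cball 0 (real m)) x *\<^sub>R f x) \<longlonglongrightarrow> f x"
    by (intro tendsto_eventually) (auto simp: eventually_sequentially)
qed

text \<open>The class assumes only \<open>w\<close> locally integrable. Local integrability of
  \<open>w powr q\<close> follows because \<open>1 / w\<close> is never 0, so an infinite mean would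
  make the product infinite. Likewise \<open>1 / 0 = \<infinity>\<close> forces
  \<open>w x > 0\<close> almost everywhere on a ball of positive mass. The bound is then raised to
  the power \<open>q\<close>.\<close>

lemma A1_class_imp_A1_weight:
  fixes w :: "real^'n \<Rightarrow> real"
  assumes "w \<in> A1_class q" and "0 < q" and nz: "\<not> (AE x in lebesgue. w x = 0)"
  obtains C where "A1_weight (\<lambda>x. w x powr q) C"
proof -
  let ?W = "\<lambda>x. w x powr q" and ?u = "unit_ball_vol (real CARD('n))"
  have w0: "\<And>x. 0 \<le> w x" and [measurable]: "w \<in> borel_measurable lebesgue"
    using assms(1) by (auto simp: A1_class_def weight_def intro: locally_integrable_imp_measurable)
  obtain C where C: "0 < C" and bound: "\<And>y r. 0 < r \<Longrightarrow>
      (wmeas ?W (ball y r) / emeasure lebesgue (ball y r)) epowr (1 / q)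
       * esssup (restrict_space lebesgue (ball y r)) (\<lambda>x. 1 / ennreal (w x)) \<le> ennreal C"
    using assms(1) by (auto simp: A1_class_def)
  have ess: "AE x in lebesgue. x \<in> ball y r \<longrightarrow>
      (wmeas ?W (ball y r) / emeasure lebesgue (ball y r)) epowr (1 / q) * (1 / ennreal (w x)) \<le> ennreal C"
    if "0 < r" for y r
  proof -
    have "AE x in restrict_space lebesgue (ball y r).
        1 / ennreal (w x) \<le> esssup (restrict_space lebesgue (ball y r)) (\<lambda>x. 1 / ennreal (w x))"
      by (rule esssup_AE)
    then have "AE x in lebesgue. x \<in> ball y r \<longrightarrow>
        1 / ennreal (w x) \<le> esssup (restrict_space lebesgue (ball y r)) (\<lambda>x. 1 / ennreal (w x))"
      by (subst (asm) AE_restrict_space_iff) auto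
    then show ?thesis
      by eventually_elim (blast intro: order_trans[OF mult_left_mono[OF _ zero_le] bound[OF that]])
  qed
  have u: "0 < ?u * r powr real CARD('n)" if "0 < r" for r
    using that by (simp add: unit_ball_vol_pos)
  have fin: "wmeas ?W (ball y r) < \<infinity>" if r: "0 < r" for y r
  proof (rule ccontr)
    assume "\<not> wmeas ?W (ball y r) < \<infinity>"
    then have "wmeas ?W (ball y r) / emeasure lebesgue (ball y r) = \<infinity>"
      using u[OF r] r by (simp add: emeasure_lborel_ball_powr less_top[symmetric] ennreal_top_divide)
    then have "(wmeas ?W (ball y r) / emeasure lebesgue (ball y r)) epowr (1 / q) = \<infinity>"
      using \<open>0 < q\<close> by (simp add: epowr_def)
    moreover have "1 / ennreal (w x) \<noteq> 0" for x
      by (simp add: ennreal_divide_eq_0_iff)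
    ultimately have "AE x in lebesgue. x \<notin> ball y r"
      using ess[OF r, of y] by (simp add: ennreal_top_mult top_unique)
    then have "emeasure lebesgue (ball y r) = 0"
      by (subst (asm) AE_iff_measurable[of "ball y r"]) auto
    then show False
      using unit_ball_vol_CARD_pos[where 'n='n] r by (simp add: emeasure_lborel_ball_powr)
  qed
  have "A1_weight ?W (C powr q * ?u)"
  proof
    show "0 < C powr q * ?u" using C by (simp add: unit_ball_vol_pos)
    show "\<not> (AE x in lebesgue. w x powr q = 0)" using nz by simp
    show "wmeas ?W (ball y r) < \<infinity>" if "0 < r" for y r by (rule fin[OF that])
    show "AE x in lebesgue. x \<in> ball y r \<longrightarrow>
        wmeas ?W (ball y r) \<le> ennreal (C powr q * ?u * r powr real CARD('n) * w x powr q)"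
      if r: "0 < r" for y r
      using ess[OF r, of y]
    proof eventually_elim
      case (elim x)
      let ?b = "?u * r powr real CARD('n)"
      obtain a where a: "wmeas ?W (ball y r) = ennreal a" "0 \<le> a"
        using fin[OF r, of y] by (cases "wmeas ?W (ball y r)") auto
      show ?case
      proof (intro impI, cases "a = 0")
        case False
        assume x: "x \<in> ball y r"
        have b: "0 < ?b" by (rule u[OF r])
        have eq: "(wmeas ?W (ball y r) / emeasure lebesgue (ball y r)) epowr (1 / q) = ennreal ((a / ?b) powr (1 / q))"
        proof -
          have "wmeas ?W (ball y r) / emeasure lebesgue (ball y r) = ennreal (a / ?b)"
            using a b r by (simp add: emeasure_lborel_ball_powr divide_ennreal)
          moreover have "0 < a / ?b" using False a b by (intro divide_pos_pos) auto
          ultimately show ?thesis by (simp only: epowr_ennreal)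
        qed
        have le: "ennreal ((a / ?b) powr (1 / q)) * (1 / ennreal (w x)) \<le> ennreal C"
          using elim x unfolding eq by blast
        have "a / ?b \<noteq> 0" using False b unfolding divide_eq_0_iff by linarith
        then have pos: "0 < (a / ?b) powr (1 / q)" by simp
        have "w x \<noteq> 0"
        proof
          assume "w x = 0"
          with le pos show False by (simp add: ennreal_mult_top top_unique)
        qed
        then have wx: "0 < w x" using w0[of x] by simp
        have "ennreal ((a / ?b) powr (1 / q) * (1 / w x)) \<le> ennreal C"
        proof -
          have "1 / ennreal (w x) = ennreal (1 / w x)"
            using wx divide_ennreal[of 1 "w x"] by simp
          with le wx show ?thesis by (subst ennreal_mult) auto
        qed
        then have "(a / ?b) powr (1 / q) * (1 / w x) \<le> C"
          using C by (subst (asm) ennreal_le_iff) auto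
        then have "(a / ?b) powr (1 / q) \<le> C * w x" using wx by (simp add: field_simps)
        then have "((a / ?b) powr (1 / q)) powr q \<le> (C * w x) powr q"
          using \<open>0 < q\<close> by (intro powr_mono2) auto
        then have "a / ?b \<le> C powr q * w x powr q"
          using \<open>0 < q\<close> a b C wx by (simp add: powr_powr powr_mult)
        then have "a \<le> C powr q * w x powr q * ?b" using b by (simp only: pos_divide_le_eq)
        then show "wmeas ?W (ball y r) \<le> ennreal (C powr q * ?u * r powr real CARD('n) * w x powr q)"
          unfolding a by (intro ennreal_leI) (simp add: mult_ac)
      qed (simp add: a)
    qed
  qed (use w0 in auto)
  with that show ?thesis .
qed

lemma Lp_norm_1_restr:
  assumes "\<And>x. 0 \<le> w x"
  shows "Lp_norm 1 w (restr B f) = (\<integral>\<^sup>+x\<in>B. ennreal (norm (f x)) * ennreal (w x) \<partial>lebesgue)"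
  unfolding Lp_norm_def
  by (simp add: restr_def, intro nn_integral_cong) (auto simp: indicator_def ennreal_mult assms)

lemma riesz_const_pos:
  assumes "0 < \<gamma>" "\<gamma> < real CARD('n::finite)"
  shows "0 < riesz_const TYPE('n) \<gamma>"
  using assms by (auto simp: riesz_const_def intro!: mult_pos_pos divide_pos_pos Gamma_real_pos)

lemma norm_frac_kernel:
  fixes f :: "real^'n \<Rightarrow> complex"
  shows "norm (frac_kernel \<gamma> f x y) = norm (f y) * norm (x - y) powr (\<gamma> - real CARD('n))"
  using powr_minus_divide[of "norm (x - y)" "real CARD('n) - \<gamma>"]
  by (simp add: frac_kernel_def norm_divide)

lemma frac_kernel_measurable:
  fixes f :: "real^'n \<Rightarrow> complex"
  assumes [measurable]: "f \<in> borel_measurable lebesgue"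
  shows "case_prod (frac_kernel \<gamma> f) \<in> borel_measurable (lebesgue \<Otimes>\<^sub>M lebesgue)"
proof -
  have "(\<lambda>p. f (snd p) / complex_of_real (norm (fst p - snd p) powr (real CARD('n) - \<gamma>)))
      \<in> borel_measurable (lebesgue \<Otimes>\<^sub>M lebesgue)"
    by measurable
  then show ?thesis by (simp add: case_prod_unfold frac_kernel_def)
qed

lemma frac_integral_measurable:
  assumes "f \<in> borel_measurable lebesgue"
  shows "frac_integral \<gamma> f \<in> borel_measurable lebesgue"
proof -
  have [measurable]: "(\<lambda>x. \<integral>y. frac_kernel \<gamma> f x y \<partial>lebesgue) \<in> borel_measurable lebesgue"
    by (rule lebesgue.borel_measurable_lebesgue_integral[OF frac_kernel_measurable[OF assms]])
  show ?thesis unfolding frac_integral_def by measurable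
qed

context A1_weight_frac
begin

lemma potential_norm:
  "potential (\<lambda>z. ennreal (norm (f z))) x = (\<integral>\<^sup>+z. ennreal (norm (frac_kernel \<gamma> f x z)) \<partial>lebesgue)"
  by (simp add: potential_def norm_frac_kernel kern_def ennreal_mult)

text \<open>This holds at every point: where the integral does not converge absolutely, its value is
  0 by convention.\<close>

lemma norm_frac_integral_le:
  "ennreal (norm (frac_integral \<gamma> f x))
    \<le> ennreal (1 / riesz_const TYPE('n) \<gamma>) * potential (\<lambda>z. ennreal (norm (f z))) x"
proof -
  have "ennreal (norm (\<integral>y. frac_kernel \<gamma> f x y \<partial>lebesgue)) \<le> potential (\<lambda>z. ennreal (norm (f z))) x"
  proof (cases "integrable lebesgue (frac_kernel \<gamma> f x)")
    case True
    then show ?thesis unfolding potential_norm by (rule integral_norm_bound_ennreal)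
  qed (simp add: not_integrable_integral_eq)
  then have "ennreal (1 / riesz_const TYPE('n) \<gamma>) * ennreal (norm (\<integral>y. frac_kernel \<gamma> f x y \<partial>lebesgue))
     \<le> ennreal (1 / riesz_const TYPE('n) \<gamma>) * potential (\<lambda>z. ennreal (norm (f z))) x"
    by (rule mult_left_mono) simp
  moreover have "norm (frac_integral \<gamma> f x)
      = 1 / riesz_const TYPE('n) \<gamma> * norm (\<integral>y. frac_kernel \<gamma> f x y \<partial>lebesgue)"
    using riesz_const_pos[OF \<gamma>_pos \<gamma>_less] by (simp add: frac_integral_def norm_mult norm_divide)
  moreover have "ennreal (1 / riesz_const TYPE('n) \<gamma> * norm (\<integral>y. frac_kernel \<gamma> f x y \<partial>lebesgue))
      = ennreal (1 / riesz_const TYPE('n) \<gamma>) * ennreal (norm (\<integral>y. frac_kernel \<gamma> f x y \<partial>lebesgue))"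
    using riesz_const_pos[OF \<gamma>_pos \<gamma>_less] by (intro ennreal_mult) auto
  ultimately show ?thesis by presburger
qed

lemma frac_integral_defined_iff:
  assumes "f \<in> borel_measurable lebesgue"
  shows "frac_integral_defined \<gamma> f x \<longleftrightarrow> potential (\<lambda>z. ennreal (norm (f z))) x < \<infinity>"
proof -
  have "frac_kernel \<gamma> f x \<in> borel_measurable lebesgue"
    using measurable_Pair2[OF frac_kernel_measurable[OF assms], of x \<gamma>] by simp
  then show ?thesis
    by (simp add: frac_integral_defined_def potential_norm integrable_iff_bounded)
qed

end

section \<open>The weight that vanishes almost everywhere\<close>

lemma weak_Lp_norm_eq_0:
  fixes w :: "real^'n \<Rightarrow> real"
  assumes "AE x in lebesgue. w x = 0" "0 < p"
  shows "weak_Lp_norm p w g = 0"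
proof -
  have "wmeas w E = 0" for E
  proof -
    have "wmeas w E = (\<integral>\<^sup>+x. 0 \<partial>(lebesgue :: (real^'n) measure))"
      unfolding wmeas_def
    proof (rule nn_integral_cong_AE)
      show "AE x in lebesgue. ennreal (w x) * indicator E x = 0"
        using assms(1) by eventually_elim simp
    qed
    then show ?thesis by simp
  qed
  then show ?thesis using assms(2) by (simp add: weak_Lp_norm_def epowr_def)
qed

text \<open>The power of the ball mass may be \<open>\<infinity>\<close> here, for a negative
  exponent, but it is multiplied by an inner norm equal to 0.\<close>

lemma weak_amalgam_norm_eq_0:
  assumes w: "AE x in lebesgue. w x = 0" and "0 < p" and "s \<noteq> 0"
  shows "weak_amalgam_norm p s \<alpha> w \<mu> f = 0"
proof -
  have "Ls_norm s \<mu> (\<lambda>y. 0) = 0"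
  proof (cases "s = \<infinity>")
    case True
    then show ?thesis by (auto simp: Ls_norm_def intro!: antisym esssup_I)
  next
    case False
    with assms have "0 < enn2real s"
      by (simp add: enn2real_positive_iff less_top zero_less_iff_neq_zero)
    with False show ?thesis by (simp add: Ls_norm_def epowr_def)
  qed
  then show ?thesis
    by (simp add: weak_amalgam_norm_def weak_Lp_norm_eq_0[OF w \<open>0 < p\<close>])
qed

text \<open>Used on the set where the potential is infinite, to which the level set estimate applies
  for every \<open>t\<close>.\<close>

lemma ennreal_eq_0_if_multiples_le:
  fixes a M :: ennreal
  assumes "\<And>t. 0 < t \<Longrightarrow> ennreal t * a \<le> M" and "M < \<infinity>"
  shows "a = 0"
proof (rule ccontr)
  assume "a \<noteq> 0"
  have "a \<le> M" using assms(1)[of 1] by simp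
  with assms(2) \<open>a \<noteq> 0\<close> obtain b where b: "a = ennreal b" "0 < b"
    by (cases a) (auto simp: top_unique)
  obtain m where m: "M = ennreal m" "0 \<le> m" using assms(2) by (cases M) auto
  have "ennreal ((m + 1) / b) * a \<le> M" using b m by (intro assms(1)) simp
  then have "ennreal (m + 1) \<le> ennreal m"
    using b m by (simp flip: ennreal_mult)
  then show False using m by (simp add: ennreal_le_iff)
qed

section \<open>Measurability of the integrands of the two outer norms\<close>

lemma borel_measurable_amalgam_integrand:
  fixes f :: "real^'n \<Rightarrow> complex"
  assumes "\<And>x. 0 \<le> w x" and [measurable]: "w \<in> borel_measurable lebesgue"
    "W \<in> borel_measurable lebesgue" "f \<in> borel_measurable lebesgue"
  shows "(\<lambda>y. wmeas W (ball y r) epowr \<epsilon> * Lp_norm 1 w (restr (ball y r) f)) \<in> borel_measurable lebesgue"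
proof -
  have [measurable]: "(\<lambda>y. \<integral>\<^sup>+x\<in>ball y r. ennreal (W x) \<partial>lebesgue) \<in> borel_measurable lebesgue"
    "(\<lambda>y. \<integral>\<^sup>+x\<in>ball y r. ennreal (norm (f x)) * ennreal (w x) \<partial>lebesgue) \<in> borel_measurable lebesgue"
    by (intro borel_measurable_nn_integral_ball; measurable)+
  show ?thesis unfolding Lp_norm_1_restr[OF assms(1)] wmeas_def by measurable
qed

lemma borel_measurable_weak_amalgam_integrand:
  fixes g :: "real^'n \<Rightarrow> complex"
  assumes [measurable]: "W \<in> borel_measurable lebesgue" "g \<in> borel_measurable lebesgue" and "0 < p"
  shows "(\<lambda>y. wmeas W (ball y r) epowr \<epsilon> * weak_Lp_norm p W (restr (ball y r) g)) \<in> borel_measurable lebesgue"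
proof -
  have [measurable]: "(\<lambda>y. \<integral>\<^sup>+x\<in>ball y r. ennreal (W x) \<partial>lebesgue) \<in> borel_measurable lebesgue"
    by (intro borel_measurable_nn_integral_ball) measurable
  have [measurable]: "(\<lambda>y. weak_Lp_norm p W (restr (ball y r) g)) \<in> borel_measurable lebesgue"
    by (intro borel_measurable_weak_Lp_norm_ball assms)
  show ?thesis unfolding wmeas_def by measurable
qed

text \<open>\<open>frac_integral\<close> has the value 0 at points of divergence, so the norm bound
  alone would not express that the operator is defined; the second conjunct does. If
  \<open>w\<close> or \<open>\<mu>\<close> vanishes almost everywhere, the amalgam norm exerts no
  control over \<open>f\<close>.\<close>

theorem theorem2p2:
  fixes w \<mu> :: "real^'n \<Rightarrow> real" and \<gamma> q \<alpha> \<beta> :: real and s :: ennreal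
  assumes "0 < \<gamma>" and "\<gamma> < real CARD('n)"
    and "q = real CARD('n) / (real CARD('n) - \<gamma>)"
    and "w \<in> A1_class q"
    and "1 \<le> \<alpha>" and "\<alpha> < \<beta>" and "ennreal \<beta> < s"
    and "1 / \<beta> = 1 / \<alpha> - \<gamma> / real CARD('n)"
    and "\<mu> \<in> Delta2"
  shows "(\<exists>C::real. C > 0 \<and>
           (\<forall>f \<in> amalgam 1 s \<alpha> w (\<lambda>x. w x powr q) \<mu>.
              frac_integral \<gamma> f \<in> weak_amalgam q s \<beta> (\<lambda>x. w x powr q) \<mu> \<and>
              weak_amalgam_norm q s \<beta> (\<lambda>x. w x powr q) \<mu> (frac_integral \<gamma> f)
                \<le> ennreal C * amalgam_norm 1 s \<alpha> w (\<lambda>x. w x powr q) \<mu> f))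
         \<and> (\<not> (AE x in lebesgue. w x = 0) \<and> \<not> (AE x in lebesgue. \<mu> x = 0) \<longrightarrow>
             (\<forall>f \<in> amalgam 1 s \<alpha> w (\<lambda>x. w x powr q) \<mu>.
                AE x in lebesgue. frac_integral_defined \<gamma> f x))"
proof -
  let ?W = "\<lambda>x. w x powr q"
  have q: "0 < q" using assms(1-3) by simp
  have s: "s \<noteq> 0" using assms(7) by auto
  have w0: "0 \<le> w x" and w_meas [measurable]: "w \<in> borel_measurable lebesgue" for x
    using assms(4) by (auto simp: A1_class_def weight_def intro: locally_integrable_imp_measurable)
  have \<mu>0: "0 \<le> \<mu> x" and \<mu>_meas [measurable]: "\<mu> \<in> borel_measurable lebesgue" for x
    using assms(9) by (auto simp: Delta2_def weight_def intro: locally_integrable_imp_measurable)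
  have f_meas: "f \<in> borel_measurable lebesgue" if "f \<in> amalgam 1 s \<alpha> w ?W \<mu>" for f
    using that by (auto simp: amalgam_def intro: locally_integrable_imp_measurable)
  show ?thesis
  proof (cases "AE x in lebesgue. w x = 0")
    \<comment> \<open>The zero weight belongs to \<open>A1_class\<close>, as
      \<open>0 * \<infinity> = 0\<close>. The weak norm is then 0 and the constant 1 serves.\<close>
    case True
    then have "AE x in lebesgue. w x powr q = 0" by simp
    then have "weak_amalgam_norm q s \<beta> ?W \<mu> g = 0" for g
      using q s by (intro weak_amalgam_norm_eq_0)
    then show ?thesis
      using True f_meas
      by (auto simp: weak_amalgam_def intro!: exI[of _ 1] frac_integral_measurable)
  next
    case False
    then obtain C0 where "A1_weight ?W C0"
      using A1_class_imp_A1_weight[OF assms(4) q] by blast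
    then interpret A1_weight ?W C0 .
    interpret A1_weight_frac ?W C0 \<gamma> by unfold_locales (use assms in auto)
    define S where "S = enn2real (1 / s)"
    define \<epsilon> where "\<epsilon> = 1 / \<alpha> - 1 - S"
    define \<eta> where "\<eta> = 1 / \<beta> - S"
    have \<kappa>q: "\<kappa> = 1 / q" using assms(3) by (simp add: \<kappa>_def)
    have \<beta>0: "0 < \<beta>" using assms by simp
    have \<epsilon>': "1 / \<beta> - 1 / q - S = \<epsilon>"
      using \<kappa>(3) assms(8) unfolding \<kappa>q by (simp add: \<epsilon>_def)
    then have \<epsilon>\<eta>: "\<epsilon> + \<kappa> = \<eta>" by (simp add: \<eta>_def \<kappa>q)
    have \<eta>: "0 < \<eta>"
    proof (cases s)
      case (real \<sigma>)
      then have "\<beta> < \<sigma>" using assms(7) \<beta>0 by (simp add: ennreal_less_iff)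
      moreover have "S = 1 / \<sigma>"
        using real \<beta>0 \<open>\<beta> < \<sigma>\<close> by (simp add: S_def divide_ennreal flip: ennreal_1)
      ultimately show ?thesis using \<beta>0 by (simp add: \<eta>_def divide_strict_left_mono)
    qed (use \<beta>0 in \<open>simp add: \<eta>_def S_def\<close>)
    \<comment> \<open>This identity turns \<open>ball_mass\<close> into the norm in
      \<open>L^1(w)\<close>.\<close>
    have \<kappa>w: "?W x powr \<kappa> = w x" for x
      using w0[of x] q by (simp add: powr_powr \<kappa>q)
    obtain K \<theta> where K: "0 < K" and \<theta>: "0 < \<theta>" "\<theta> < 1" and level:
      "\<And>h y r E t. h \<in> borel_measurable lebesgue \<Longrightarrow> 0 < r \<Longrightarrow> E \<in> sets lebesgue \<Longrightarrow> E \<subseteq> ball y r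
      \<Longrightarrow> 0 < t \<Longrightarrow> (\<And>x. x \<in> E \<Longrightarrow> ennreal t \<le> potential h x) \<Longrightarrow>
      wmeas ?W (ball y r) epowr \<epsilon> * (ennreal t * wmeas ?W E epowr \<kappa>)
        \<le> ennreal K * (\<Sum>k. ennreal (\<theta> ^ k) *
            (wmeas ?W (ball y (2 ^ Suc k * r)) epowr \<epsilon> * ball_mass h y (2 ^ Suc k * r)))"
      by (rule level_set_le[OF \<eta> \<epsilon>\<eta>]) blast
    obtain D where D: "0 < D" and geometric:
      "\<And>G N. (\<And>k. G k \<in> borel_measurable lebesgue) \<Longrightarrow> (\<And>k. Ls_norm s \<mu> (G k) \<le> N) \<Longrightarrow>
        Ls_norm s \<mu> (\<lambda>y. \<Sum>k. ennreal (\<theta> ^ k) * G k y) \<le> ennreal D * N"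
      by (rule Ls_norm_geometric_series[OF \<theta> s \<mu>_meas]) blast
    define Z where "Z = 1 / riesz_const TYPE('n) \<gamma>"
    have Z: "0 < Z" using riesz_const_pos[OF assms(1,2)] by (simp add: Z_def)
    define G where "G f r k y = wmeas ?W (ball y (2 ^ Suc k * r)) epowr \<epsilon>
        * Lp_norm 1 w (restr (ball y (2 ^ Suc k * r)) f)" for f r k y
    define T where "T f r y = (\<Sum>k. ennreal (\<theta> ^ k) * G f r k y)" for f r y
    have mass: "ball_mass (\<lambda>z. ennreal (norm (f z))) y r = Lp_norm 1 w (restr (ball y r) f)" for f y r
      by (simp add: ball_mass_def \<kappa>w Lp_norm_1_restr[OF w0])
    have level': "wmeas ?W (ball y r) epowr \<epsilon> * (ennreal t * wmeas ?W E epowr (1 / q)) \<le> ennreal K * T f r y"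
      if "f \<in> borel_measurable lebesgue" "0 < r" "E \<in> sets lebesgue" "E \<subseteq> ball y r" "0 < t"
        "\<And>x. x \<in> E \<Longrightarrow> ennreal t \<le> potential (\<lambda>z. ennreal (norm (f z))) x" for f y r E t
      using level[of "\<lambda>z. ennreal (norm (f z))" r E y t] that
      by (simp add: mass T_def G_def \<kappa>q)
    have G_meas [measurable]: "G f r k \<in> borel_measurable lebesgue"
      if "f \<in> borel_measurable lebesgue" for f r k
      unfolding G_def using that
      by (intro borel_measurable_amalgam_integrand w0) auto
    have T_meas: "T f r \<in> borel_measurable lebesgue" if [measurable]: "f \<in> borel_measurable lebesgue" for f r
      unfolding T_def by measurable
    let ?N = "amalgam_norm 1 s \<alpha> w ?W \<mu>"
    have T_norm: "Ls_norm s \<mu> (T f r) \<le> ennreal D * ?N f"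
      if "f \<in> borel_measurable lebesgue" "0 < r" for f r
    proof -
      have "Ls_norm s \<mu> (G f r k) \<le> ?N f" for k
        unfolding amalgam_norm_def G_def using that(2)
        by (intro SUP_upper2[of "2 ^ Suc k * r"]) (auto simp: \<epsilon>_def S_def)
      with geometric[of "G f r" "?N f"] G_meas[OF that(1)] show ?thesis
        by (simp add: T_def[abs_def])
    qed
    have weak_le: "weak_amalgam_norm q s \<beta> ?W \<mu> (frac_integral \<gamma> f) \<le> ennreal (Z * K * D) * ?N f"
      if f: "f \<in> borel_measurable lebesgue" for f
      unfolding weak_amalgam_norm_def
    proof (rule SUP_least)
      fix r :: real assume "r \<in> {0<..}"
      then have r: "0 < r" by simp
      let ?g = "frac_integral \<gamma> f"
      have g [measurable]: "?g \<in> borel_measurable lebesgue" by (rule frac_integral_measurable[OF f])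
      have pt: "wmeas ?W (ball y r) epowr (1 / \<beta> - 1 / q - enn2real (1 / s))
          * weak_Lp_norm q ?W (restr (ball y r) ?g) \<le> ennreal (Z * K) * T f r y" for y
        unfolding S_def[symmetric] \<epsilon>' weak_Lp_norm_def SUP_mult_left_ennreal
      proof (rule SUP_least)
        fix t :: real assume "t \<in> {0<..}"
        then have t: "0 < t" by simp
        let ?E = "{x. t < norm (restr (ball y r) ?g x)}"
        have E: "?E = ball y r \<inter> (\<lambda>x. norm (?g x)) -` {t<..}"
          using t by (auto simp: restr_def)
        have "(\<lambda>x. norm (?g x)) -` {t<..} \<in> sets lebesgue"
          using measurable_sets[OF measurable_compose[OF g borel_measurable_norm], of "{t<..}"] by simp
        then have E_sets: "?E \<in> sets lebesgue" unfolding E by (intro sets.Int) auto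
        \<comment> \<open>The normalising constant of the operator is absorbed into the level, so
          the estimate for potentials is applied at \<open>t / Z\<close>.\<close>
        have "ennreal (t / Z) \<le> potential (\<lambda>z. ennreal (norm (f z))) x" if "x \<in> ?E" for x
        proof -
          have "ennreal t \<le> ennreal (norm (?g x))" using that E by (intro ennreal_leI) auto
          also have "\<dots> \<le> ennreal Z * potential (\<lambda>z. ennreal (norm (f z))) x"
            unfolding Z_def by (rule norm_frac_integral_le)
          finally have "ennreal (1 / Z) * ennreal t
              \<le> ennreal (1 / Z) * (ennreal Z * potential (\<lambda>z. ennreal (norm (f z))) x)"
            by (rule mult_left_mono) simp
          then show ?thesis
            using Z t by (simp add: mult.assoc[symmetric] ennreal_mult[symmetric])
        qed
        then have le: "wmeas ?W (ball y r) epowr \<epsilon> * (ennreal (t / Z) * wmeas ?W ?E epowr (1 / q))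
            \<le> ennreal K * T f r y"
          using E t Z by (intro level' f r E_sets) auto
        have "ennreal t = ennreal Z * ennreal (t / Z)"
          using Z t by (simp flip: ennreal_mult)
        then have "wmeas ?W (ball y r) epowr \<epsilon> * (ennreal t * wmeas ?W ?E epowr (1 / q))
            = ennreal Z * (wmeas ?W (ball y r) epowr \<epsilon> * (ennreal (t / Z) * wmeas ?W ?E epowr (1 / q)))"
          by (simp only: mult_ac)
        also have "\<dots> \<le> ennreal Z * (ennreal K * T f r y)"
          by (intro mult_left_mono le) simp
        also have "\<dots> = ennreal (Z * K) * T f r y"
          using Z K by (simp add: ennreal_mult mult.assoc)
        finally show "wmeas ?W (ball y r) epowr \<epsilon> * (ennreal t * wmeas ?W ?E epowr (1 / q))
            \<le> ennreal (Z * K) * T f r y" .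
      qed
      have "Ls_norm s \<mu> (\<lambda>y. wmeas ?W (ball y r) epowr (1 / \<beta> - 1 / q - enn2real (1 / s))
          * weak_Lp_norm q ?W (restr (ball y r) ?g)) \<le> Ls_norm s \<mu> (\<lambda>y. ennreal (Z * K) * T f r y)"
        by (intro Ls_norm_mono pt s borel_measurable_weak_amalgam_integrand g q) measurable
      also have "\<dots> \<le> ennreal (Z * K) * Ls_norm s \<mu> (T f r)"
        using Z K by (intro Ls_norm_cmult_le T_meas f \<mu>_meas s) simp
      also have "\<dots> \<le> ennreal (Z * K) * (ennreal D * ?N f)"
        by (intro mult_left_mono T_norm f r) simp
      also have "\<dots> = ennreal (Z * K * D) * ?N f"
        using Z K D by (simp add: ennreal_mult mult.assoc)
      finally show "Ls_norm s \<mu> (\<lambda>y. wmeas ?W (ball y r) epowr (1 / \<beta> - 1 / q - enn2real (1 / s))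
          * weak_Lp_norm q ?W (restr (ball y r) ?g)) \<le> ennreal (Z * K * D) * ?N f" .
    qed
    have bounded: "frac_integral \<gamma> f \<in> weak_amalgam q s \<beta> ?W \<mu> \<and>
        weak_amalgam_norm q s \<beta> ?W \<mu> (frac_integral \<gamma> f) \<le> ennreal (Z * K * D) * ?N f"
      if "f \<in> amalgam 1 s \<alpha> w ?W \<mu>" for f
    proof -
      have "ennreal (Z * K * D) * ?N f < \<infinity>"
        using that by (simp add: amalgam_def ennreal_mult_less_top)
      then show ?thesis
        using weak_le[OF f_meas[OF that]] frac_integral_measurable[OF f_meas[OF that]]
        by (auto simp: weak_amalgam_def)
    qed
    \<comment> \<open>The series \<open>T\<close> is finite at some centre. The level set estimate
      there, valid for all \<open>t\<close>, makes the set of infinite potential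
      \<open>W\<close>-null, hence Lebesgue null because \<open>W > 0\<close> almost
      everywhere.\<close>
    have defined: "AE x in lebesgue. frac_integral_defined \<gamma> f x"
      if f: "f \<in> amalgam 1 s \<alpha> w ?W \<mu>" and nz: "\<not> (AE x in lebesgue. \<mu> x = 0)" for f
    proof -
      note fm [measurable] = f_meas[OF f]
      let ?h = "\<lambda>z. ennreal (norm (f z))"
      have "AE y in lebesgue. 0 < \<mu> y \<longrightarrow> T f (real (Suc m)) y < \<infinity>" for m
      proof (rule Ls_norm_finite_imp_AE_finite[OF T_meas[OF fm] \<mu>_meas s])
        have "ennreal D * ?N f < \<infinity>"
          using f by (simp add: amalgam_def ennreal_mult_less_top)
        then show "Ls_norm s \<mu> (T f (real (Suc m))) < \<infinity>"
          using T_norm[OF fm, of "real (Suc m)"] by simp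
      qed
      then have ae: "AE y in lebesgue. \<forall>m. 0 < \<mu> y \<longrightarrow> T f (real (Suc m)) y < \<infinity>"
        unfolding AE_all_countable by blast
      \<comment> \<open>One centre must work for all radii, so that the balls around it exhaust the
        space. It exists because \<open>\<mu>\<close> is positive on a set that is not null.\<close>
      have "\<exists>y. \<forall>m. T f (real (Suc m)) y < \<infinity>"
      proof (rule ccontr)
        assume none: "\<not> (\<exists>y. \<forall>m. T f (real (Suc m)) y < \<infinity>)"
        from ae have "AE y in lebesgue. \<mu> y = 0"
        proof eventually_elim
          case (elim y)
          with none have "\<not> 0 < \<mu> y" by blast
          with \<mu>0[of y] show ?case by simp
        qed
        with nz show False ..
      qed
      then obtain y where y: "\<And>m. T f (real (Suc m)) y < \<infinity>" by blast
      have "AE x in lebesgue. x \<in> ball y (real (Suc m)) \<longrightarrow> potential ?h x < \<infinity>" for m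
      proof -
        let ?r = "real (Suc m)"
        let ?E = "ball y ?r \<inter> potential ?h -` {\<infinity>}"
        have "potential ?h -` {\<infinity>} \<in> sets lebesgue"
          using measurable_sets[OF potential_measurable[of ?h], of "{\<infinity>}"] by simp
        then have E: "?E \<in> sets lebesgue" by (intro sets.Int) auto
        have "ennreal t * (wmeas ?W (ball y ?r) epowr \<epsilon> * wmeas ?W ?E epowr (1 / q)) \<le> ennreal K * T f ?r y"
          if "0 < t" for t
          using level'[OF fm, of ?r ?E y t] E that by (simp add: mult_ac)
        then have "wmeas ?W (ball y ?r) epowr \<epsilon> * wmeas ?W ?E epowr (1 / q) = 0"
        proof (rule ennreal_eq_0_if_multiples_le)
          show "ennreal K * T f ?r y < \<infinity>" using y[of m] by (simp add: ennreal_mult_less_top)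
        qed
        \<comment> \<open>The ball has positive finite mass, so this power is nonzero whatever the
          sign of \<open>\<epsilon>\<close>.\<close>
        moreover have "wmeas ?W (ball y ?r) epowr \<epsilon> \<noteq> 0"
          using v_pos[of ?r y] by (simp add: wmeas_ball epowr_ennreal)
        ultimately have "wmeas ?W ?E = 0"
          using q by (simp only: mult_eq_0_iff epowr_eq_0_iff zero_less_divide_1_iff simp_thms)
        then have "AE x in lebesgue. ennreal (?W x) * indicator ?E x = 0"
          unfolding wmeas_def using E by (subst (asm) nn_integral_0_iff_AE) auto
        then show ?thesis using W_pos_AE
          by eventually_elim (auto simp: indicator_def less_top split: if_splits)
      qed
      then have "AE x in lebesgue. \<forall>m. x \<in> ball y (real (Suc m)) \<longrightarrow> potential ?h x < \<infinity>"
        unfolding AE_all_countable by blast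
      then show ?thesis
      proof eventually_elim
        case (elim x)
        obtain m where "dist y x < real m" using reals_Archimedean2 by blast
        then have "x \<in> ball y (real (Suc m))" by simp
        with elim show ?case unfolding frac_integral_defined_iff[OF fm] by blast
      qed
    qed
    have "0 < Z * K * D" using Z K D by simp
    with bounded defined show ?thesis by blast
  qed
qed

end
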